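(* Let $K$ be a field of characteristic $0$ and let $n\geq 2$. Let $U_n$ be the associative unital $K$-algebra generated by $l_1,\ldots,l_n,r_1,\ldots,r_n$ with defining relations $l_il_j=l_jl_i$ and $r_il_j=l_jr_i+r_ir_j$ for all $1\leq i,j\leq n$, and let $L_n=K[l_1,\ldots,l_n]$ be the polynomial algebra in $n$ variables. Then the groups of $K$-algebra automorphisms of $U_n$ and of $L_n$ are isomorphic: $\mathrm{Aut}(U_n)\cong \mathrm{Aut}(L_n)$.
   Context: $U_n$ is the universal multiplicative enveloping algebra, in the variety of left-symmetric algebras, of the $n$-dimensional $K$-algebra with zero multiplication. Automorphisms are unital $K$-algebra automorphisms. *)

theory Defs
  imports Complex_Main "HOL-Library.Poly_Mapping" "HOL-Library.Cardinality" "HOL-Algebra.Group"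
begin

section \<open>Monoid algebras\<close>

text \<open>
  For an additively written monoid \<^typ>\<open>'m\<close>, the type \<open>'m \<Rightarrow>\<^sub>0 'k\<close> with the convolution product
  of \<^theory>\<open>HOL-Library.Poly_Mapping\<close> is the monoid algebra of \<^typ>\<open>'m\<close> over \<^typ>\<open>'k\<close>.
  Both free associative algebras (\<^typ>\<open>'m\<close> a free monoid) and polynomial algebras
  (\<^typ>\<open>'m\<close> a free commutative monoid, i.e. the monoid of exponent vectors) are instances.
\<close>

definition pm_scale :: "'k::field \<Rightarrow> ('m \<Rightarrow>\<^sub>0 'k) \<Rightarrow> ('m \<Rightarrow>\<^sub>0 'k)"
  where "pm_scale c p = Poly_Mapping.map ((*) c) p"

lemma lookup_pm_scale: "Poly_Mapping.lookup (pm_scale c p) m = c * Poly_Mapping.lookup p m"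
  by (cases "Poly_Mapping.lookup p m = 0") (simp_all add: pm_scale_def map.rep_eq)

lemma pm_scale_conv_mult: "pm_scale c p = Poly_Mapping.single 0 c * p"
  for p :: "'m::monoid_add \<Rightarrow>\<^sub>0 'k::field"
  by (simp add: pm_scale_def mult_map_scale_conv_mult)

lemma pm_scale_mult_left: "pm_scale c p * q = pm_scale c (p * q)"
  for p :: "'m::monoid_add \<Rightarrow>\<^sub>0 'k::field"
  by (simp add: pm_scale_conv_mult mult.assoc)

lemma single_0_commute: "Poly_Mapping.single 0 c * p = p * Poly_Mapping.single 0 c"
  for p :: "'m::monoid_add \<Rightarrow>\<^sub>0 'k::field"
proof (rule poly_mapping_eqI)
  fix m
  have "(\<Sum>v. (c when 0 = v) when m = u + v) = (c when m = u)" for u :: 'm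
  proof -
    have "(\<lambda>v. (c when 0 = v) when m = u + v) = (\<lambda>v. (c when m = u) when v = 0)"
      by (auto simp: when_def fun_eq_iff)
    then have "(\<Sum>v. (c when 0 = v) when m = u + v) =
        (\<Sum>v::'m. (c when m = u) when v = 0)"
      by (simp only:)
    then show ?thesis by simp
  qed
  then have "Poly_Mapping.lookup (p * Poly_Mapping.single 0 c) m = Poly_Mapping.lookup p m * c"
    by (simp add: times_poly_mapping.rep_eq prod_fun_def lookup_single mult_when)
  then show "Poly_Mapping.lookup (Poly_Mapping.single 0 c * p) m =
      Poly_Mapping.lookup (p * Poly_Mapping.single 0 c) m"
    by (simp add: lookup_pm_scale mult.commute flip: pm_scale_conv_mult)
qed

lemma pm_scale_mult_right: "p * pm_scale c q = pm_scale c (p * q)"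
  for p :: "'m::monoid_add \<Rightarrow>\<^sub>0 'k::field"
  by (metis pm_scale_conv_mult single_0_commute mult.assoc)

lemma vector_space_pm_scale: "vector_space (pm_scale :: 'k::field \<Rightarrow> ('m \<Rightarrow>\<^sub>0 'k) \<Rightarrow> _)"
  by unfold_locales
    (auto intro!: poly_mapping_eqI simp: lookup_pm_scale lookup_add algebra_simps)


section \<open>The free associative algebra\<close>

datatype 'a fmonoid = FM (letters: "'a list")

instantiation fmonoid :: (type) monoid_add
begin
definition "0 = FM []"
definition "u + v = FM (letters u @ letters v)"
instance by standard (simp_all add: zero_fmonoid_def plus_fmonoid_def)
end

type_synonym ('a, 'k) free_algebra = "'a fmonoid \<Rightarrow>\<^sub>0 'k"

definition fa_var :: "'a \<Rightarrow> ('a, 'k::field) free_algebra"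
  where "fa_var x = Poly_Mapping.single (FM [x]) 1"

text \<open>
  The two-sided ideal generated by a set. In an algebra over a field it is automatically a
  subspace, scalar multiplication being multiplication by a scalar multiple of 1.
\<close>

inductive_set two_sided_ideal :: "'a::ring_1 set \<Rightarrow> 'a set"
  for S :: "'a set" where
  zero: "0 \<in> two_sided_ideal S"
| base: "s \<in> S \<Longrightarrow> s \<in> two_sided_ideal S"
| add: "x \<in> two_sided_ideal S \<Longrightarrow> y \<in> two_sided_ideal S \<Longrightarrow> x + y \<in> two_sided_ideal S"
| mult_left: "x \<in> two_sided_ideal S \<Longrightarrow> a * x \<in> two_sided_ideal S"
| mult_right: "x \<in> two_sided_ideal S \<Longrightarrow> x * a \<in> two_sided_ideal S"

lemma two_sided_ideal_uminus: "x \<in> two_sided_ideal S \<Longrightarrow> - x \<in> two_sided_ideal S"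
  using two_sided_ideal.mult_left[of x S "- 1"] by simp

lemma two_sided_ideal_diff:
  "x \<in> two_sided_ideal S \<Longrightarrow> y \<in> two_sided_ideal S \<Longrightarrow> x - y \<in> two_sided_ideal S"
  using two_sided_ideal.add[of x S "- y"] by (simp add: two_sided_ideal_uminus)


section \<open>The algebra \<open>U\<^sub>n\<close>\<close>

text \<open>
  The algebra is presented by generators \<open>l\<^sub>i\<close>, \<open>r\<^sub>i\<close> and relations
  \<open>l\<^sub>i l\<^sub>j = l\<^sub>j l\<^sub>i\<close> and \<open>r\<^sub>i l\<^sub>j = l\<^sub>j r\<^sub>i + r\<^sub>i r\<^sub>j\<close> for all \<open>i\<close>, \<open>j\<close>.
  The index set \<open>{1,\<dots>,n}\<close> is represented by a type \<^typ>\<open>'n\<close> with \<open>n\<close> elements.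
\<close>

datatype 'n gen = Lgen 'n | Rgen 'n

definition U_relators :: "('n gen, 'k::field) free_algebra set" where
  "U_relators =
    {fa_var (Lgen i) * fa_var (Lgen j) - fa_var (Lgen j) * fa_var (Lgen i) | i j. True} \<union>
    {fa_var (Rgen i) * fa_var (Lgen j) -
      (fa_var (Lgen j) * fa_var (Rgen i) + fa_var (Rgen i) * fa_var (Rgen j)) | i j. True}"

lemma fa_const_coeff_mult:
  "Poly_Mapping.lookup (p * q) 0 = Poly_Mapping.lookup p 0 * Poly_Mapping.lookup q 0"
  for p q :: "('a, 'k::field) free_algebra"
proof -
  have *: "0 = u + v \<longleftrightarrow> u = 0 \<and> v = 0" for u v :: "'a fmonoid"
    by (cases u; cases v) (auto simp: zero_fmonoid_def plus_fmonoid_def)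
  have "(\<Sum>v. Poly_Mapping.lookup q v when 0 = u + v) = (Poly_Mapping.lookup q 0 when u = 0)"
    for u :: "'a fmonoid"
    by (cases "u = 0") (simp_all add: *)
  then show ?thesis
    by (simp add: times_poly_mapping.rep_eq prod_fun_def mult_when)
qed

lemma U_ideal_const_coeff:
  fixes x :: "('n gen, 'k::field) free_algebra"
  shows "x \<in> two_sided_ideal U_relators \<Longrightarrow> Poly_Mapping.lookup x 0 = 0"
proof (induction rule: two_sided_ideal.induct)
  case (base s)
  have "Poly_Mapping.lookup (fa_var a :: ('n gen, 'k) free_algebra) 0 = 0" for a :: "'n gen"
    by (simp add: fa_var_def lookup_single zero_fmonoid_def)
  with base show ?case
    by (auto simp: U_relators_def lookup_minus lookup_add fa_const_coeff_mult)
qed (simp_all add: lookup_add fa_const_coeff_mult)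

definition U_rel ::
    "('n gen, 'k::field) free_algebra \<Rightarrow> ('n gen, 'k) free_algebra \<Rightarrow> bool"
  where "U_rel p q \<longleftrightarrow> p - q \<in> two_sided_ideal U_relators"

lemma equivp_U_rel: "equivp (U_rel :: ('n gen, 'k::field) free_algebra \<Rightarrow> _)"
proof (rule equivpI)
  show "reflp (U_rel :: ('n gen, 'k) free_algebra \<Rightarrow> _)"
    by (auto intro!: reflpI simp: U_rel_def two_sided_ideal.zero)
  show "symp (U_rel :: ('n gen, 'k) free_algebra \<Rightarrow> _)"
    by (rule sympI, unfold U_rel_def) (metis minus_diff_eq two_sided_ideal_uminus)
  show "transp (U_rel :: ('n gen, 'k) free_algebra \<Rightarrow> _)"
  proof (rule transpI)
    fix p q t :: "('n gen, 'k) free_algebra"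
    assume "U_rel p q" "U_rel q t"
    then show "U_rel p t"
      using two_sided_ideal.add[of "p - q" U_relators "q - t"] by (simp add: U_rel_def)
  qed
qed

quotient_type (overloaded) ('n, 'k) U = "('n gen, 'k::field) free_algebra" / U_rel
  by (rule equivp_U_rel)

instantiation U :: (type, field) ring_1
begin

lift_definition zero_U :: "('a, 'b) U" is 0 .
lift_definition one_U :: "('a, 'b) U" is 1 .

lift_definition plus_U :: "('a, 'b) U \<Rightarrow> ('a, 'b) U \<Rightarrow> ('a, 'b) U" is "(+)"
  unfolding U_rel_def by (simp add: add_diff_add two_sided_ideal.add)

lift_definition uminus_U :: "('a, 'b) U \<Rightarrow> ('a, 'b) U" is uminus
  unfolding U_rel_def by (simp only: minus_diff_minus two_sided_ideal_uminus)

lift_definition minus_U :: "('a, 'b) U \<Rightarrow> ('a, 'b) U \<Rightarrow> ('a, 'b) U" is "(-)"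
proof -
  fix p p' q q' :: "('a gen, 'b) free_algebra"
  assume "U_rel p p'" "U_rel q q'"
  moreover have "p - q - (p' - q') = (p - p') - (q - q')"
    by simp
  ultimately show "U_rel (p - q) (p' - q')"
    unfolding U_rel_def by (simp only: two_sided_ideal_diff)
qed

lift_definition times_U :: "('a, 'b) U \<Rightarrow> ('a, 'b) U \<Rightarrow> ('a, 'b) U" is "(*)"
proof -
  fix p p' q q' :: "('a gen, 'b) free_algebra"
  assume "U_rel p p'" "U_rel q q'"
  moreover have "p * q - p' * q' = (p - p') * q + p' * (q - q')"
    by (simp add: algebra_simps)
  ultimately show "U_rel (p * q) (p' * q')"
    by (simp add: U_rel_def two_sided_ideal.intros)
qed

instance
proof
  fix a b c :: "('a, 'b) U"
  have refl: "p = q \<Longrightarrow> U_rel p q" for p q :: "('a gen, 'b) free_algebra"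
    by (simp add: U_rel_def two_sided_ideal.zero)
  show "a + b + c = a + (b + c)" by transfer (rule refl, simp add: algebra_simps)
  show "a + b = b + a" by transfer (rule refl, simp add: algebra_simps)
  show "0 + a = a" by transfer (rule refl, simp)
  show "- a + a = 0" by transfer (rule refl, simp)
  show "a - b = a + - b" by transfer (rule refl, simp)
  show "a * b * c = a * (b * c)" by transfer (rule refl, simp add: mult.assoc)
  show "(a + b) * c = a * c + b * c" by transfer (rule refl, simp add: algebra_simps)
  show "a * (b + c) = a * b + a * c" by transfer (rule refl, simp add: algebra_simps)
  show "1 * a = a" by transfer (rule refl, simp)
  show "a * 1 = a" by transfer (rule refl, simp)
  show "(0 :: ('a, 'b) U) \<noteq> 1"
    by transfer (auto simp: U_rel_def lookup_minus dest!: U_ideal_const_coeff)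
qed

end

lift_definition U_scale :: "'k::field \<Rightarrow> ('n, 'k) U \<Rightarrow> ('n, 'k) U" is pm_scale
  unfolding U_rel_def pm_scale_conv_mult
  by (simp add: two_sided_ideal.mult_left flip: right_diff_distrib)

lemma vector_space_U_scale: "vector_space (U_scale :: 'k::field \<Rightarrow> ('n, 'k) U \<Rightarrow> _)"
proof -
  interpret vector_space "pm_scale :: 'k \<Rightarrow> ('n gen, 'k) free_algebra \<Rightarrow> _"
    by (rule vector_space_pm_scale)
  have refl: "p = q \<Longrightarrow> U_rel p q" for p q :: "('n gen, 'k) free_algebra"
    by (simp add: U_rel_def two_sided_ideal.zero)
  show ?thesis
    by unfold_locales
      (transfer, rule refl, simp add: scale_right_distrib scale_left_distrib)+
qed

lemma U_scale_mult_left: "U_scale c x * y = U_scale c (x * y)"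
  by transfer (simp add: pm_scale_mult_left U_rel_def two_sided_ideal.zero)

lemma U_scale_mult_right: "x * U_scale c y = U_scale c (x * y)"
  by transfer (simp add: pm_scale_mult_right U_rel_def two_sided_ideal.zero)

lift_definition U_l :: "'n \<Rightarrow> ('n, 'k::field) U" is "\<lambda>i. fa_var (Lgen i)" .
lift_definition U_r :: "'n \<Rightarrow> ('n, 'k::field) U" is "\<lambda>i. fa_var (Rgen i)" .

lemma U_l_commute: "U_l i * U_l j = U_l j * U_l i"
  by transfer (unfold U_rel_def U_relators_def, rule two_sided_ideal.base, blast)

lemma U_r_l: "U_r i * U_l j = U_l j * U_r i + U_r i * U_r j"
  by transfer (unfold U_rel_def U_relators_def, rule two_sided_ideal.base, blast)


section \<open>The polynomial algebra \<open>L\<^sub>n\<close>\<close>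

text \<open>Monomials are exponent vectors \<open>'n \<Rightarrow>\<^sub>0 nat\<close>.\<close>

type_synonym ('n, 'k) L = "('n \<Rightarrow>\<^sub>0 nat) \<Rightarrow>\<^sub>0 'k"


section \<open>Automorphism groups\<close>

definition algebra_auts :: "('k::field \<Rightarrow> 'a::ring_1 \<Rightarrow> 'a) \<Rightarrow> ('a \<Rightarrow> 'a) set" where
  "algebra_auts scale =
    {f. bij f \<and> Vector_Spaces.linear scale scale f \<and> f 1 = 1 \<and> (\<forall>x y. f (x * y) = f x * f y)}"

definition Aut :: "('k::field \<Rightarrow> 'a::ring_1 \<Rightarrow> 'a) \<Rightarrow> ('a \<Rightarrow> 'a) monoid" where
  "Aut scale = \<lparr>carrier = algebra_auts scale, mult = (\<circ>), one = id\<rparr>"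

lemma group_Aut:
  assumes "vector_space scale"
  shows "group (Aut scale)"
proof -
  interpret vector_space scale by fact
  interpret vector_space_pair scale scale ..
  show ?thesis
  proof (rule groupI)
    fix f assume "f \<in> carrier (Aut scale)"
    then have f: "bij f" "Vector_Spaces.linear scale scale f" "f 1 = 1"
        "\<And>x y. f (x * y) = f x * f y"
      by (auto simp: Aut_def algebra_auts_def)
    have inv: "f (inv_into UNIV f x) = x" "inv_into UNIV f (f x) = x" for x
      using f(1) by (simp_all add: bij_is_surj surj_f_inv_f bij_is_inj)
    have eq: "inv_into UNIV f y = x" if "f x = y" for x y using that inv by auto
    interpret f: Vector_Spaces.linear scale scale f by fact
    have "bij (inv_into UNIV f)" using f(1) by (rule bij_imp_bij_inv)
    moreover have "Vector_Spaces.linear scale scale (inv_into UNIV f)"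
      by unfold_locales (auto intro!: eq simp: f.add f.scale inv)
    moreover have "inv_into UNIV f 1 = 1"
        "\<And>x y. inv_into UNIV f (x * y) = inv_into UNIV f x * inv_into UNIV f y"
      by (auto intro!: eq simp: f inv)
    ultimately have "inv_into UNIV f \<in> algebra_auts scale" by (simp add: algebra_auts_def)
    moreover have "inv_into UNIV f \<circ> f = id" by (auto simp: inv)
    ultimately show "\<exists>g\<in>carrier (Aut scale). g \<otimes>\<^bsub>Aut scale\<^esub> f = \<one>\<^bsub>Aut scale\<^esub>"
      by (auto simp: Aut_def)
  next
    show "\<one>\<^bsub>Aut scale\<^esub> \<in> carrier (Aut scale)"
      by (simp add: Aut_def algebra_auts_def linear_id)
  qed (auto simp: Aut_def algebra_auts_def bij_comp intro: Vector_Spaces.linear_compose)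
qed

end

theory Submission
  imports Defs "HOL-Computational_Algebra.Polynomial" "HOL-Algebra.Coset"
begin

text \<open>
  Put \<open>s\<^sub>i = l\<^sub>i - r\<^sub>i\<close>. The relations of \<open>U\<^sub>n\<close> say that the \<open>l\<^sub>i\<close> commute, the \<open>s\<^sub>i\<close> commute and
  \<open>r\<^sub>i s\<^sub>j = l\<^sub>j r\<^sub>i\<close>, and they imply the same relation \<open>(f(l) - f(s)) g(s) = g(l) (f(l) - f(s))\<close> for all
  polynomials \<open>f\<close>, \<open>g\<close>. Hence automorphisms of \<open>L\<^sub>n\<close> lift to \<open>U\<^sub>n\<close>. Conversely an automorphism \<open>\<psi>\<close> of
  \<open>U\<^sub>n\<close> preserves the ideal generated by the \<open>r\<^sub>i\<close>, because \<open>r\<^sub>i\<^sup>2\<close> is a commutator, and so induces an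
  automorphism of the quotient \<open>L\<^sub>n\<close>.

  Suppose that \<open>\<psi>\<close> induces the identity on \<open>L\<^sub>n\<close>. Comparing terms quadratic in the \<open>r\<^sub>i\<close> shows that
  \<open>\<psi> r\<^sub>i - r\<^sub>i\<close> and \<open>\<psi> l\<^sub>j - l\<^sub>j\<close> have order at least two in the \<open>r\<^sub>i\<close> (here \<open>n \<ge> 2\<close> is used). For a suitable
  weight, in whose associated graded algebra the \<open>l\<^sub>j\<close> are central, the leading forms \<open>R\<^sub>i\<close> of \<open>\<psi> r\<^sub>i\<close> and
  \<open>E\<^sub>j\<close> of \<open>\<psi> l\<^sub>j - l\<^sub>j\<close> satisfy \<open>\<delta>\<^sub>j R\<^sub>i + [R\<^sub>i, E\<^sub>j] = R\<^sub>i R\<^sub>j\<close>, where \<open>\<delta>\<^sub>j\<close> is the derivation with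
  \<open>\<delta>\<^sub>j r\<^sub>i = r\<^sub>i r\<^sub>j\<close>. If \<open>R\<^sub>j\<close> had degree at least two in the \<open>r\<^sub>i\<close>, all powers (from the square on) of its top form
  would have trace zero, which is impossible in characteristic 0. So \<open>R\<^sub>j = r\<^sub>j\<close>, and then \<open>E\<^sub>j\<close> commutes
  with all \<open>r\<^sub>i\<close> and vanishes, which forces \<open>\<psi> = id\<close>.
\<close>

section \<open>Linear extension\<close>

definition pm_sum :: "('m \<Rightarrow> 'a::zero \<Rightarrow> 'b::comm_monoid_add) \<Rightarrow> ('m \<Rightarrow>\<^sub>0 'a) \<Rightarrow> 'b"
  where "pm_sum f p = (\<Sum>m\<in>Poly_Mapping.keys p. f m (Poly_Mapping.lookup p m))"

lemma pm_sum_zero [simp]: "pm_sum f 0 = 0"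
  by (simp add: pm_sum_def)

lemma pm_sum_single [simp]: "f m 0 = 0 \<Longrightarrow> pm_sum f (Poly_Mapping.single m c) = f m c"
  by (simp add: pm_sum_def)

lemma pm_sum_add:
  assumes "\<And>m a b. f m (a + b) = f m a + f m b" and "\<And>m. f m 0 = 0"
  shows "pm_sum f (p + q) = pm_sum f p + pm_sum f q"
  unfolding pm_sum_def by (rule setsum_keys_plus_distrib) (simp_all add: assms)

lemma pm_sum_single_id: "pm_sum Poly_Mapping.single p = p"
proof (rule poly_mapping_eqI)
  fix m
  have "Poly_Mapping.lookup (pm_sum Poly_Mapping.single p) m =
      (\<Sum>k\<in>Poly_Mapping.keys p. if k = m then Poly_Mapping.lookup p k else 0)"
    by (auto simp: pm_sum_def lookup_sum lookup_single when_def intro!: sum.cong)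
  then show "Poly_Mapping.lookup (pm_sum Poly_Mapping.single p) m = Poly_Mapping.lookup p m"
    by (simp add: in_keys_iff)
qed

text \<open>Only monomials of \<open>p\<close> itself, with their coefficients in \<open>p\<close>,
  have to be treated, so degree or weight bounds on \<open>p\<close> are available in the case
  \<open>single\<close>.\<close>

lemma pm_induct [case_names zero add single]:
  assumes zero: "P 0" and add: "\<And>p q. P p \<Longrightarrow> P q \<Longrightarrow> P (p + q)"
    and single: "\<And>m. Poly_Mapping.lookup p m \<noteq> 0 \<Longrightarrow> P (Poly_Mapping.single m (Poly_Mapping.lookup p m))"
  shows "P (p :: 'm \<Rightarrow>\<^sub>0 'a::comm_monoid_add)"
proof -
  have "P (\<Sum>m\<in>M. Poly_Mapping.single m (Poly_Mapping.lookup p m))"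
    if "finite M" "M \<subseteq> Poly_Mapping.keys p" for M
    using that by (induction M rule: finite_induct) (auto simp: zero add single in_keys_iff)
  then have "P (pm_sum Poly_Mapping.single p)"
    unfolding pm_sum_def by simp
  then show ?thesis
    by (simp add: pm_sum_single_id)
qed

lemma additive_eqI:
  fixes F G :: "('m \<Rightarrow>\<^sub>0 'a::comm_monoid_add) \<Rightarrow> 'b::ab_group_add"
  assumes "\<And>p q. F (p + q) = F p + F q" and "\<And>p q. G (p + q) = G p + G q"
    and "\<And>m c. F (Poly_Mapping.single m c) = G (Poly_Mapping.single m c)"
  shows "F p = G p"
proof (induction p rule: pm_induct)
  case zero
  have "F 0 = 0" "G 0 = 0"
    using assms(1)[of 0 0] assms(2)[of 0 0] by auto
  then show ?case by simp
qed (simp_all add: assms)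

lemma pm_sum_mult:
  fixes f :: "'m::monoid_add \<Rightarrow> 'a::semiring_0 \<Rightarrow> 'b::ring"
  assumes add: "\<And>m a b. f m (a + b) = f m a + f m b"
    and mult: "\<And>m n a b. f (m + n) (a * b) = f m a * f n b"
  shows "pm_sum f (p * q) = pm_sum f p * pm_sum f q"
proof -
  have 0: "f m 0 = 0" for m
    using add[of m 0 0] by simp
  note a = pm_sum_add[of f, OF add 0]
  show ?thesis
  proof (induction p rule: pm_induct)
    case (single m)
    show ?case
      by (induction q rule: pm_induct) (simp_all add: a 0 mult mult_single distrib_left)
  qed (simp_all add: a distrib_right)
qed


section \<open>The polynomial algebra\<close>

definition L_var :: "'n \<Rightarrow> ('n, 'k::field) L"
  where "L_var i = Poly_Mapping.single (Poly_Mapping.single i 1) 1"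

lemma exponent_induct [case_names zero add]:
  fixes a :: "'n \<Rightarrow>\<^sub>0 nat"
  assumes zero: "P 0" and add: "\<And>i b. P b \<Longrightarrow> P (Poly_Mapping.single i 1 + b)"
  shows "P a"
proof -
  have s: "P b \<Longrightarrow> P (Poly_Mapping.single i k + b)" for b :: "'n \<Rightarrow>\<^sub>0 nat" and i k
  proof (induction k)
    case (Suc k)
    have "Poly_Mapping.single i (Suc k) + b =
        Poly_Mapping.single i 1 + (Poly_Mapping.single i k + b)"
      by (simp flip: single_add add.assoc)
    with Suc add[of "Poly_Mapping.single i k + b" i] show ?case by simp
  qed simp
  have "P b \<Longrightarrow> P (a + b)" for b
    by (induction a arbitrary: b rule: pm_induct) (simp_all add: s add.assoc)
  from this[of 0] zero show ?thesis by simp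
qed

lemma L_induct [case_names add const var]:
  fixes f :: "('n, 'k::field) L"
  assumes add: "\<And>f g. P f \<Longrightarrow> P g \<Longrightarrow> P (f + g)"
    and const: "\<And>c. P (pm_scale c 1)" and var: "\<And>i f. P f \<Longrightarrow> P (L_var i * f)"
  shows "P f"
proof (induction f rule: pm_induct)
  case zero
  from const[of 0] show ?case
    by (simp add: pm_scale_conv_mult)
next
  case (single m)
  have "P (Poly_Mapping.single m c)" for c
  proof (induction m rule: exponent_induct)
    case zero
    from const[of c] show ?case by (simp add: pm_scale_conv_mult)
  next
    case (add i b)
    from var[OF this, of i] show ?case by (simp add: L_var_def mult_single)
  qed
  then show ?case .
qed (rule add)

text \<open>Numbering the variables by natural numbers embeds \<open>L_n\<close> into a polynomial
  ring whose exponent vectors are linearly ordered; there leading monomials multiply, so a product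
  of nonzero elements is nonzero.\<close>

lemma L_no_zero_divisors:
  fixes f g :: "('n::finite, 'k::field) L"
  assumes "f * g = 0"
  shows "f = 0 \<or> g = 0"
proof -
  obtain ix :: "'n \<Rightarrow> nat" where ix: "inj ix"
    using finite_imp_inj_to_nat_seg[of "UNIV :: 'n set"] by auto
  define e :: "('n \<Rightarrow>\<^sub>0 nat) \<Rightarrow> nat \<Rightarrow>\<^sub>0 nat"
    where "e a = (\<Sum>i\<in>UNIV. Poly_Mapping.single (ix i) (Poly_Mapping.lookup a i))" for a
  have e_add: "e (a + b) = e a + e b" for a b
    by (simp add: e_def lookup_add single_add sum.distrib)
  have "Poly_Mapping.lookup (e a) (ix j) = Poly_Mapping.lookup a j" for a j
    by (simp add: e_def lookup_sum lookup_single when_def inj_eq[OF ix])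
  then have e_inj: "e a = e b \<longleftrightarrow> a = b" for a b
    by (metis poly_mapping_eqI)
  define E :: "('n, 'k) L \<Rightarrow> (nat \<Rightarrow>\<^sub>0 nat) \<Rightarrow>\<^sub>0 'k"
    where "E = pm_sum (\<lambda>a. Poly_Mapping.single (e a))"
  have E_add: "E (p + q) = E p + E q" for p q
    unfolding E_def by (rule pm_sum_add) (simp_all add: single_add)
  have E_mult: "E (p * q) = E p * E q" for p q
    unfolding E_def by (rule pm_sum_mult) (simp_all add: single_add mult_single e_add)
  have "Poly_Mapping.lookup (E p) (e a) = Poly_Mapping.lookup p a" for p a
  proof (rule additive_eqI[where F = "\<lambda>p. Poly_Mapping.lookup (E p) (e a)"])
    show "Poly_Mapping.lookup (E (Poly_Mapping.single m c)) (e a) =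
        Poly_Mapping.lookup (Poly_Mapping.single m c) a" for m c
      by (simp add: E_def lookup_single e_inj)
  qed (simp_all add: E_add lookup_add)
  then have E_0: "p = 0" if "E p = 0" for p
    using that by (metis lookup_zero poly_mapping_eqI)
  have "E f * E g = 0"
    using assms E_mult[of f g] by (simp add: E_def)
  then show ?thesis
    using E_0 by auto
qed


section \<open>Algebra homomorphisms\<close>

definition alg_hom ::
    "('k::field \<Rightarrow> 'a::ring_1 \<Rightarrow> 'a) \<Rightarrow> ('k \<Rightarrow> 'b::ring_1 \<Rightarrow> 'b) \<Rightarrow> ('a \<Rightarrow> 'b) \<Rightarrow> bool"
  where "alg_hom s1 s2 h \<longleftrightarrow>
    Vector_Spaces.linear s1 s2 h \<and> h 1 = 1 \<and> (\<forall>x y. h (x * y) = h x * h y)"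

lemma alg_homD:
  assumes "alg_hom s1 s2 h"
  shows "h (x + y) = h x + h y" "h (s1 c x) = s2 c (h x)" "h 1 = 1" "h (x * y) = h x * h y"
    "h 0 = 0" "h (x - y) = h x - h y" "h (sum g A) = (\<Sum>i\<in>A. h (g i))"
proof -
  interpret Vector_Spaces.linear s1 s2 h
    using assms by (simp add: alg_hom_def)
  show "h (x + y) = h x + h y" "h (s1 c x) = s2 c (h x)" "h 1 = 1" "h (x * y) = h x * h y"
    "h 0 = 0" "h (x - y) = h x - h y" "h (sum g A) = (\<Sum>i\<in>A. h (g i))"
    using assms by (simp_all add: alg_hom_def add scale zero diff sum)
qed

lemma alg_homI:
  assumes "vector_space s1" "vector_space s2"
    and "\<And>x y. h (x + y) = h x + h y" "\<And>c x. h (s1 c x) = s2 c (h x)" "h 1 = 1"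
    and "\<And>x y. h (x * y) = h x * h y"
  shows "alg_hom s1 s2 h"
  using assms by (simp add: alg_hom_def Vector_Spaces.linear_iff)

lemma alg_hom_comp: "alg_hom s1 s2 g \<Longrightarrow> alg_hom s2 s3 h \<Longrightarrow> alg_hom s1 s3 (h \<circ> g)"
  by (auto simp: alg_hom_def intro: Vector_Spaces.linear_compose)

lemma alg_hom_id: "vector_space s \<Longrightarrow> alg_hom s s id"
  by (intro alg_homI) simp_all

lemma mem_algebra_auts: "f \<in> algebra_auts s \<longleftrightarrow> bij f \<and> alg_hom s s f"
  by (auto simp: algebra_auts_def alg_hom_def)

lemma L_alg_hom_eqI:
  assumes g: "alg_hom pm_scale s g" and h: "alg_hom pm_scale s h"
    and "\<And>i. g (L_var i) = h (L_var i)"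
  shows "g f = h f"
  by (induction f rule: L_induct)
    (simp_all add: alg_homD[OF g] alg_homD[OF h] assms(3))

text \<open>The target need not be commutative: powers of the commuting \<open>b i\<close>,
  multiplied in a fixed order \<open>xs\<close> of the variables, depend multiplicatively on the
  exponent vector, and linear extension gives \<open>h\<close>.\<close>

lemma L_alg_hom_exists:
  fixes b :: "'n::finite \<Rightarrow> 'b::ring_1" and s :: "'k::field \<Rightarrow> 'b \<Rightarrow> 'b"
  assumes "vector_space s" and s: "\<And>c x y. s c x * y = s c (x * y)" "\<And>c x y. x * s c y = s c (x * y)"
    and comm: "\<And>i j. b i * b j = b j * b i"
  obtains h where "alg_hom pm_scale s h" "\<And>i. h (L_var i) = b i"
proof -
  interpret vector_space s by fact
  obtain xs :: "'n list" where xs: "distinct xs" "set xs = UNIV"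
    using finite_distinct_list[of "UNIV :: 'n set"] by auto
  define mon where "mon ys a = (\<Prod>i\<leftarrow>ys. b i ^ Poly_Mapping.lookup a i)" for ys a
  have comm': "b i ^ k * mon ys a = mon ys a * b i ^ k" for i k ys a
  proof (induction ys)
    case (Cons j ys)
    have "b i ^ k * b j ^ l = b j ^ l * b i ^ k" for l
      by (intro power_commuting_commutes power_commuting_commutes[symmetric] comm)
    moreover have "mon (j # ys) a = b j ^ Poly_Mapping.lookup a j * mon ys a"
      by (simp add: mon_def)
    ultimately show ?case
      using Cons by (metis mult.assoc)
  qed (simp add: mon_def)
  have mon_add: "mon ys (a + c) = mon ys a * mon ys c" for ys a c
  proof (induction ys)
    case (Cons j ys)
    have "mon (j # ys) (a + c) = b j ^ Poly_Mapping.lookup a j *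
        (b j ^ Poly_Mapping.lookup c j * mon ys a) * mon ys c"
      using Cons by (simp add: mon_def lookup_add power_add mult.assoc)
    also have "\<dots> = mon (j # ys) a * mon (j # ys) c"
      unfolding comm' by (simp add: mon_def mult.assoc)
    finally show ?case .
  qed (simp add: mon_def)
  have mon_0: "mon ys 0 = 1" for ys
    by (induction ys) (simp_all add: mon_def)
  have "mon ys (Poly_Mapping.single i 1) = (if i \<in> set ys then b i else 1)" if "distinct ys" for ys i
    using that by (induction ys) (auto simp: mon_def lookup_single when_def)
  then have mon_single: "mon xs (Poly_Mapping.single i 1) = b i" for i
    using xs by simp
  define h where "h = pm_sum (\<lambda>a c. s c (mon xs a))"
  have h_add: "h (p + q) = h p + h q" for p q
    unfolding h_def by (rule pm_sum_add) (simp_all add: scale_left_distrib)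
  have h_mult: "h (p * q) = h p * h q" for p q
    unfolding h_def by (rule pm_sum_mult) (simp_all add: scale_left_distrib mon_add s mult.commute)
  have h_const: "h (Poly_Mapping.single 0 c) = s c 1" for c
    by (simp add: h_def mon_0)
  from this[of 1] have h_1: "h 1 = 1"
    by simp
  show ?thesis
  proof
    show "alg_hom pm_scale s h"
      by (rule alg_homI) (simp_all add: vector_space_pm_scale h_add h_mult h_1 h_const
          pm_scale_conv_mult s vector_space_axioms)
    show "h (L_var i) = b i" for i
      using mon_single by (simp add: h_def L_var_def)
  qed
qed

section \<open>Representations and universal property of \<open>U\<^sub>n\<close>\<close>

lemma U_induct [case_names add const l r]:
  fixes u :: "('n, 'k::field) U"
  assumes add: "\<And>u v. P u \<Longrightarrow> P v \<Longrightarrow> P (u + v)"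
    and const: "\<And>c. P (U_scale c 1)"
    and l: "\<And>i u. P u \<Longrightarrow> P (U_l i * u)" and r: "\<And>i u. P u \<Longrightarrow> P (U_r i * u)"
  shows "P u"
proof -
  have "P (abs_U p)" for p
  proof (induction p rule: pm_induct)
    case zero
    from const[of 0] show ?case
      by (simp add: one_U.abs_eq U_scale.abs_eq pm_scale_conv_mult)
  next
    case (add p q)
    then show ?case
      using assms(1)[of "abs_U p" "abs_U q"] by (simp add: plus_U.abs_eq)
  next
    case (single w)
    have "P (abs_U (Poly_Mapping.single (FM ws) c))" for ws c
    proof (induction ws)
      case Nil
      from const[of c] show ?case
        by (simp add: one_U.abs_eq U_scale.abs_eq pm_scale_conv_mult zero_fmonoid_def)
    next
      case (Cons g ws)
      have "Poly_Mapping.single (FM (g # ws)) c = fa_var g * Poly_Mapping.single (FM ws) c"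
        by (simp add: fa_var_def mult_single plus_fmonoid_def)
      then have "abs_U (Poly_Mapping.single (FM (g # ws)) c) =
          (case g of Lgen i \<Rightarrow> U_l i | Rgen i \<Rightarrow> U_r i) * abs_U (Poly_Mapping.single (FM ws) c)"
        by (simp add: times_U.abs_eq U_l.abs_eq U_r.abs_eq split: gen.split)
      then show ?case
        using Cons l r by (simp split: gen.split)
    qed
    from this[of "letters w"] show ?case by simp
  qed
  then show ?thesis
    by (induction u rule: U.abs_induct) simp
qed

text \<open>The free algebra acts word by word through \<open>T\<close>. The assumptions say that
  the relators act by zero, hence so does the ideal they generate, and the action descends to
  \<open>U_n\<close>. This yields both the universal property and the normal forms.\<close>

lemma U_rep_exists:
  fixes T :: "'n gen \<Rightarrow> 'b \<Rightarrow> 'b::ab_group_add" and s :: "'k::field \<Rightarrow> 'b \<Rightarrow> 'b"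
  assumes lin: "\<And>g. Vector_Spaces.linear s s (T g)"
    and ll: "\<And>i j x. T (Lgen i) (T (Lgen j) x) = T (Lgen j) (T (Lgen i) x)"
    and rl: "\<And>i j x. T (Rgen i) (T (Lgen j) x) = T (Lgen j) (T (Rgen i) x) + T (Rgen i) (T (Rgen j) x)"
  obtains \<rho> where "\<And>u v x. \<rho> (u + v) x = \<rho> u x + \<rho> v x"
    and "\<And>c u x. \<rho> (U_scale c u) x = s c (\<rho> u x)"
    and "\<And>x. \<rho> 1 x = x" and "\<And>u v x. \<rho> (u * v) x = \<rho> u (\<rho> v x)"
    and "\<And>i. \<rho> (U_l i) = T (Lgen i)" and "\<And>i. \<rho> (U_r i) = T (Rgen i)"
proof -
  interpret vector_space s
    using lin[of undefined] by (simp add: Vector_Spaces.linear_iff)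
  have T: "T g (x + y) = T g x + T g y" "T g (s c x) = s c (T g x)" for g x y c
    using lin[of g] by (simp_all add: Vector_Spaces.linear_iff)
  define word where "word w x = foldr T (letters w) x" for w x
  have "foldr T gs (x + y) = foldr T gs x + foldr T gs y" "foldr T gs (s c x) = s c (foldr T gs x)"
    for gs x y c
    by (induction gs) (simp_all add: T)
  then have word: "word w (x + y) = word w x + word w y" "word w (s c x) = s c (word w x)"
      "word 0 x = x" "word (v + w) x = word v (word w x)" for v w x y c
    by (simp_all add: word_def zero_fmonoid_def plus_fmonoid_def)
  define act where "act p x = pm_sum (\<lambda>w c. s c (word w x)) p" for p x
  have act_add: "act (p + q) x = act p x + act q x" for p q x
    unfolding act_def by (rule pm_sum_add) (simp_all add: scale_left_distrib)
  have act_single: "act (Poly_Mapping.single w c) x = s c (word w x)" for w c x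
    by (simp add: act_def)
  have act_0: "act 0 x = 0" for x
    by (simp add: act_def)
  have act_lin: "act p (x + y) = act p x + act p y \<and> act p (s c x) = s c (act p x)" for p x y c
    by (induction p rule: pm_induct)
      (simp_all add: act_0 act_add act_single word scale_right_distrib mult.commute)
  have act_right_0: "act p 0 = 0" for p
    using act_lin[of p 0 0] by simp
  have act_mult: "act (p * q) x = act p (act q x)" for p q x
  proof (induction p rule: pm_induct)
    case (single m)
    show ?case
      by (induction q rule: pm_induct)
        (simp_all add: act_0 act_add act_right_0 act_single act_lin word mult_single distrib_left
          scale_right_distrib)
  qed (simp_all add: act_0 act_add distrib_right)
  have act_diff: "act (p - q) x = act p x - act q x" for p q x
    using act_add[of "p - q" q x] by simp
  have act_var: "act (fa_var g) x = T g x" for g x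
    by (simp add: fa_var_def act_single word_def)
  have "act z x = 0" if "z \<in> two_sided_ideal U_relators" for z x
    using that
  proof (induction arbitrary: x rule: two_sided_ideal.induct)
    case (base z)
    then show ?case
      by (auto simp: U_relators_def act_diff act_add act_mult act_var rl) (simp add: ll)
  qed (simp_all add: act_0 act_add act_mult act_right_0)
  then have rel: "act p x = act q x" if "U_rel p q" for p q x
    using that act_diff[of p q x] by (simp add: U_rel_def)
  \<comment> \<open>By \<open>rel\<close> every representative of \<open>u\<close> gives the same
    operator.\<close>
  define \<rho> where "\<rho> u x = act (rep_U u) x" for u x
  have \<rho>: "\<rho> (abs_U p) x = act p x" for p x
    unfolding \<rho>_def
    by (rule rel) (simp add: Quotient3_rep_abs[OF Quotient3_U] equivp_reflp[OF equivp_U_rel])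
  show ?thesis
  proof
    fix u v :: "('n, 'k) U" and x c
    have "\<exists>p. w = abs_U p" for w :: "('n, 'k) U"
      by (induction w rule: U.abs_induct) blast
    then obtain p q where [simp]: "u = abs_U p" "v = abs_U q"
      by blast
    show "\<rho> (u + v) x = \<rho> u x + \<rho> v x" "\<rho> (u * v) x = \<rho> u (\<rho> v x)"
      by (simp_all add: plus_U.abs_eq times_U.abs_eq \<rho> act_add act_mult)
    show "\<rho> (U_scale c u) x = s c (\<rho> u x)"
      by (simp add: U_scale.abs_eq \<rho> pm_scale_conv_mult act_mult act_single word)
    show "\<rho> 1 x = x"
      by (simp add: one_U.abs_eq \<rho> act_single word flip: single_one)
  next
    show "\<rho> (U_l i) = T (Lgen i)" "\<rho> (U_r i) = T (Rgen i)" for i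
      by (auto simp: U_l.abs_eq U_r.abs_eq \<rho> act_var)
  qed
qed

text \<open>The target is made a \<open>U_n\<close>-module by left multiplications with the
  \<open>a i\<close> and \<open>b i\<close>; the homomorphism sends \<open>u\<close> to its value at
  1.\<close>

lemma U_alg_hom_exists:
  fixes a b :: "'n \<Rightarrow> 'b::ring_1" and s :: "'k::field \<Rightarrow> 'b \<Rightarrow> 'b"
  assumes vs: "vector_space s"
    and s: "\<And>c x y. s c x * y = s c (x * y)" "\<And>c x y. x * s c y = s c (x * y)"
    and ll: "\<And>i j. a i * a j = a j * a i" and rl: "\<And>i j. b i * a j = a j * b i + b i * b j"
  obtains h where "alg_hom U_scale s h" "\<And>i. h (U_l i) = a i" "\<And>i. h (U_r i) = b i"
proof -
  define T where "T g x = (case g of Lgen i \<Rightarrow> a i | Rgen i \<Rightarrow> b i) * x" for g x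
  have lin: "Vector_Spaces.linear s s (T g)" for g
    using vs by (simp add: Vector_Spaces.linear_iff T_def distrib_left s)
  have ll': "T (Lgen i) (T (Lgen j) x) = T (Lgen j) (T (Lgen i) x)" for i j x
    by (simp add: T_def ll flip: mult.assoc)
  have rl': "T (Rgen i) (T (Lgen j) x) = T (Lgen j) (T (Rgen i) x) + T (Rgen i) (T (Rgen j) x)"
    for i j x
    by (simp add: T_def rl distrib_right flip: mult.assoc)
  obtain \<rho> where \<rho>: "\<And>u v x. \<rho> (u + v) x = \<rho> u x + \<rho> v x"
      "\<And>c u x. \<rho> (U_scale c u) x = s c (\<rho> u x)"
      "\<And>x. \<rho> 1 x = x" "\<And>u v x. \<rho> (u * v) x = \<rho> u (\<rho> v x)"
      "\<And>i. \<rho> (U_l i) = T (Lgen i)" "\<And>i. \<rho> (U_r i) = T (Rgen i)"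
    by (rule U_rep_exists[OF lin ll' rl']) blast
  \<comment> \<open>Every \<open>u\<close> acts as a left multiplication, which makes
    \<open>\<rho> u 1\<close> multiplicative in \<open>u\<close>.\<close>
  have \<rho>_mult: "\<rho> u x = \<rho> u 1 * x" for u x
  proof (induction u arbitrary: x rule: U_induct)
    case (add u v)
    show ?case
      using add(1)[of x] add(2)[of x] by (simp add: \<rho> distrib_right)
  next
    case (l i u)
    show ?case
      using l[of x] by (simp add: \<rho> T_def mult.assoc)
  next
    case (r i u)
    show ?case
      using r[of x] by (simp add: \<rho> T_def mult.assoc)
  qed (simp add: \<rho> s)
  show ?thesis
  proof
    show "alg_hom U_scale s (\<lambda>u. \<rho> u 1)"
      by (rule alg_homI) (simp_all add: vs vector_space_U_scale \<rho> flip: \<rho>_mult)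
    show "\<rho> (U_l i) 1 = a i" "\<rho> (U_r i) 1 = b i" for i
      by (simp_all add: \<rho> T_def)
  qed
qed

lemma U_alg_hom_eqI:
  assumes g: "alg_hom U_scale s g" and h: "alg_hom U_scale s h"
    and "\<And>i. g (U_l i) = h (U_l i)" "\<And>i. g (U_r i) = h (U_r i)"
  shows "g u = h u"
  by (induction u rule: U_induct)
    (simp_all add: alg_homD[OF g] alg_homD[OF h] assms(3,4))

section \<open>Evaluation maps between \<open>L_n\<close> and \<open>U_n\<close>\<close>

definition L_to_U :: "('n::finite, 'k::field) L \<Rightarrow> ('n, 'k) U"
  where "L_to_U = (SOME h. alg_hom pm_scale U_scale h \<and> (\<forall>i. h (L_var i) = U_l i))"

definition U_s :: "'n \<Rightarrow> ('n, 'k::field) U"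
  where "U_s i = U_l i - U_r i"

definition L_to_U' :: "('n::finite, 'k::field) L \<Rightarrow> ('n, 'k) U"
  where "L_to_U' = (SOME h. alg_hom pm_scale U_scale h \<and> (\<forall>i. h (L_var i) = U_s i))"

definition U_to_L :: "('n::finite, 'k::field) U \<Rightarrow> ('n, 'k) L"
  where "U_to_L = (SOME h. alg_hom U_scale pm_scale h \<and>
    (\<forall>i. h (U_l i) = L_var i) \<and> (\<forall>i. h (U_r i) = 0))"

lemma U_r_s: "U_r i * U_s j = U_l j * U_r i"
  by (simp add: U_s_def right_diff_distrib U_r_l)

text \<open>By \<open>U_r_s\<close> the product is l_i l_j - (l_i r_j + l_j r_i), an expression
  symmetric in i and j.\<close>

lemma U_s_commute: "U_s i * U_s j = (U_s j * U_s i :: ('n, 'k::field) U)"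
proof -
  have *: "U_s i * U_s j = (U_l i * U_s j - U_l j * U_r i :: ('n, 'k) U)" for i j :: 'n
    by (simp add: U_s_def[of i] left_diff_distrib U_r_s)
  have "U_s i * U_s j = (U_l i * U_l j - (U_l i * U_r j + U_l j * U_r i) :: ('n, 'k) U)"
    for i j :: 'n
    unfolding * by (simp add: U_s_def right_diff_distrib)
  then show ?thesis
    by (simp add: U_l_commute[of i j] add.commute)
qed

lemma L_to_U_hom: "alg_hom pm_scale U_scale (L_to_U :: ('n::finite, 'k::field) L \<Rightarrow> _)"
  and L_to_U_var [simp]: "L_to_U (L_var i) = (U_l i :: ('n, 'k) U)"
proof -
  have "\<exists>h :: ('n, 'k) L \<Rightarrow> _. alg_hom pm_scale U_scale h \<and> (\<forall>i. h (L_var i) = U_l i)"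
    by (rule L_alg_hom_exists[where b = U_l, OF vector_space_U_scale U_scale_mult_left
          U_scale_mult_right U_l_commute]) blast
  from someI_ex[OF this] show "alg_hom pm_scale U_scale (L_to_U :: ('n, 'k) L \<Rightarrow> _)"
      "L_to_U (L_var i) = (U_l i :: ('n, 'k) U)"
    by (simp_all add: L_to_U_def)
qed

lemma L_to_U'_hom: "alg_hom pm_scale U_scale (L_to_U' :: ('n::finite, 'k::field) L \<Rightarrow> _)"
  and L_to_U'_var [simp]: "L_to_U' (L_var i) = (U_s i :: ('n, 'k) U)"
proof -
  have "\<exists>h :: ('n, 'k) L \<Rightarrow> _. alg_hom pm_scale U_scale h \<and> (\<forall>i. h (L_var i) = U_s i)"
    by (rule L_alg_hom_exists[where b = U_s, OF vector_space_U_scale U_scale_mult_left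
          U_scale_mult_right U_s_commute]) blast
  from someI_ex[OF this] show "alg_hom pm_scale U_scale (L_to_U' :: ('n, 'k) L \<Rightarrow> _)"
      "L_to_U' (L_var i) = (U_s i :: ('n, 'k) U)"
    by (simp_all add: L_to_U'_def)
qed

lemma U_to_L_hom: "alg_hom U_scale pm_scale (U_to_L :: _ \<Rightarrow> ('n::finite, 'k::field) L)"
  and U_to_L_l [simp]: "U_to_L (U_l i) = (L_var i :: ('n, 'k) L)"
  and U_to_L_r [simp]: "U_to_L (U_r i) = (0 :: ('n, 'k) L)"
proof -
  have "\<exists>h :: _ \<Rightarrow> ('n, 'k) L. alg_hom U_scale pm_scale h \<and>
      (\<forall>i. h (U_l i) = L_var i) \<and> (\<forall>i. h (U_r i) = 0)"
    by (rule U_alg_hom_exists[OF vector_space_pm_scale, where a = L_var and b = "\<lambda>_. 0"])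
      (auto simp: pm_scale_mult_left pm_scale_mult_right mult.commute)
  from someI_ex[OF this] show "alg_hom U_scale pm_scale (U_to_L :: _ \<Rightarrow> ('n, 'k) L)"
      "U_to_L (U_l i) = (L_var i :: ('n, 'k) L)" "U_to_L (U_r i) = (0 :: ('n, 'k) L)"
    by (simp_all add: U_to_L_def)
qed

lemma U_to_L_to_U [simp]: "U_to_L (L_to_U f) = f"
  by (induction f rule: L_induct)
    (simp_all add: alg_homD[OF U_to_L_hom] alg_homD[OF L_to_U_hom])

text \<open>Since l_j r_i = r_i s_j, the right ideal generated by the r_i is stable under left
  multiplication by the generators. Modulo it every element is a polynomial in the l_i, and
  \<open>U_to_L\<close> detects that polynomial.\<close>

lemma U_to_L_eq_0:
  assumes "U_to_L u = 0"
  obtains x where "u = (\<Sum>i\<in>UNIV. U_r i * x i)"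
proof -
  have "\<exists>x. u = L_to_U (U_to_L u) + (\<Sum>i\<in>UNIV. U_r i * x i)" for u
  proof (induction u rule: U_induct)
    case (add u v)
    then obtain x y where xy: "u = L_to_U (U_to_L u) + (\<Sum>i\<in>UNIV. U_r i * x i)"
        "v = L_to_U (U_to_L v) + (\<Sum>i\<in>UNIV. U_r i * y i)" by blast
    have "u + v = L_to_U (U_to_L (u + v)) + (\<Sum>i\<in>UNIV. U_r i * (x i + y i))"
      using arg_cong2[OF xy, of "(+)"]
      by (simp add: alg_homD[OF U_to_L_hom] alg_homD[OF L_to_U_hom] distrib_left sum.distrib add_ac)
    then show ?case by (rule exI[of _ "\<lambda>i. x i + y i"])
  next
    case (const c)
    then show ?case
      by (intro exI[of _ "\<lambda>_. 0"]) (simp add: alg_homD[OF U_to_L_hom] alg_homD[OF L_to_U_hom])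
  next
    case (l j u)
    then obtain x where "u = L_to_U (U_to_L u) + (\<Sum>i\<in>UNIV. U_r i * x i)" by blast
    then have "U_l j * u = L_to_U (U_to_L (U_l j * u)) + (\<Sum>i\<in>UNIV. U_l j * (U_r i * x i))"
      by (simp add: alg_homD[OF U_to_L_hom] alg_homD[OF L_to_U_hom] sum_distrib_left)
        (metis distrib_left sum_distrib_left)
    also have "(\<Sum>i\<in>UNIV. U_l j * (U_r i * x i)) = (\<Sum>i\<in>UNIV. U_r i * (U_s j * x i))"
      by (simp add: U_r_s flip: mult.assoc)
    finally show ?case by (rule exI[of _ "\<lambda>i. U_s j * x i"])
  next
    case (r j u)
    have "U_r j * u = (\<Sum>i\<in>UNIV. U_r i * (if i = j then u else 0))"
      by (simp add: if_distrib cong: if_cong)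
    then show ?case
      by (intro exI[of _ "\<lambda>i. if i = j then u else 0"])
        (simp add: alg_homD[OF U_to_L_hom] alg_homD[OF L_to_U_hom])
  qed
  from this[of u] assms that show ?thesis
    by (auto simp: alg_homD[OF L_to_U_hom])
qed


section \<open>Lifting automorphisms from \<open>L\<^sub>n\<close> to \<open>U\<^sub>n\<close>\<close>

text \<open>
  \<open>f \<mapsto> L_to_U f - L_to_U' f\<close> is a twisted derivation with \<open>L_var i \<mapsto> U_r i\<close>, so the defining
  relations between the \<open>U_r i\<close> and \<open>U_s j\<close> propagate to all of \<open>L\<^sub>n\<close>.
\<close>

lemma L_to_U_diff_mult:
  "(L_to_U f - L_to_U' f) * L_to_U' g = L_to_U g * (L_to_U f - L_to_U' f)"
proof -
  note hom = alg_homD[OF L_to_U_hom] alg_homD[OF L_to_U'_hom]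
  \<comment> \<open>This is the case where \<open>f\<close> is a variable.\<close>
  have r: "U_r i * L_to_U' g = L_to_U g * U_r i" for i g
  proof (induction g rule: L_induct)
    case (var j g)
    have "U_r i * L_to_U' (L_var j * g) = U_l j * (U_r i * L_to_U' g)"
      by (simp add: hom U_r_s flip: mult.assoc)
    also have "\<dots> = L_to_U (L_var j * g) * U_r i"
      by (simp add: hom var mult.assoc)
    finally show ?case .
  qed (simp_all add: hom distrib_left distrib_right U_scale_mult_left U_scale_mult_right)
  have comm': "L_to_U' f * L_to_U' g = L_to_U' g * L_to_U' f" for f g
    by (simp add: mult.commute flip: hom)
  show ?thesis
  proof (induction f rule: L_induct)
    case (var i f)
    let ?d = "L_to_U f - L_to_U' f"
    have "L_to_U (L_var i * f) - L_to_U' (L_var i * f) = U_r i * L_to_U' f + U_l i * ?d"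
      by (simp add: hom U_s_def left_diff_distrib right_diff_distrib)
    moreover have "U_r i * L_to_U' f * L_to_U' g = L_to_U g * (U_r i * L_to_U' f)"
      by (metis mult.assoc comm' r)
    moreover have "U_l i * L_to_U g = L_to_U g * U_l i"
      by (simp add: mult.commute flip: hom L_to_U_var)
    then have "U_l i * ?d * L_to_U' g = L_to_U g * (U_l i * ?d)"
      by (metis mult.assoc var)
    ultimately show ?case
      by (simp add: distrib_left distrib_right)
  qed (simp_all add: hom algebra_simps)
qed

text \<open>The lift sends l_i to the polynomial \<open>\<phi> (L_var i)\<close> evaluated at the
  l's, and s_i to the same polynomial evaluated at the s's; \<open>L_to_U_diff_mult\<close> gives
  the relations. Tracking \<open>L_to_U'\<close> as well allows a composite of lifts to be
  recognised as the identity.\<close>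

lemma L_end_lift:
  fixes \<phi> :: "('n::finite, 'k::field) L \<Rightarrow> ('n, 'k) L"
  assumes \<phi>: "alg_hom pm_scale pm_scale \<phi>"
  obtains \<psi> where "alg_hom U_scale U_scale \<psi>"
    "\<And>f. \<psi> (L_to_U f) = L_to_U (\<phi> f)" "\<And>f. \<psi> (L_to_U' f) = L_to_U' (\<phi> f)"
proof -
  define a where "a i = L_to_U (\<phi> (L_var i))" for i
  define b where "b i = a i - L_to_U' (\<phi> (L_var i))" for i
  have ll: "a i * a j = a j * a i" for i j
    unfolding a_def by (simp add: mult.commute flip: alg_homD[OF L_to_U_hom])
  have "b i * (a j - b j) = a j * b i" for i j
    unfolding b_def a_def using L_to_U_diff_mult by simp
  then have rl: "b i * a j = a j * b i + b i * b j" for i j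
    by (simp add: right_diff_distrib diff_eq_eq)
  obtain \<psi> where \<psi>: "alg_hom U_scale U_scale \<psi>" "\<And>i. \<psi> (U_l i) = a i" "\<And>i. \<psi> (U_r i) = b i"
    by (rule U_alg_hom_exists[where a = a and b = b, OF vector_space_U_scale U_scale_mult_left
          U_scale_mult_right ll rl]) blast
  show ?thesis
  proof
    show "alg_hom U_scale U_scale \<psi>" by fact
    have "(\<psi> \<circ> L_to_U) f = (L_to_U \<circ> \<phi>) f" for f
      by (rule L_alg_hom_eqI[OF alg_hom_comp[OF L_to_U_hom \<psi>(1)] alg_hom_comp[OF \<phi> L_to_U_hom]])
        (simp add: \<psi> a_def)
    then show "\<psi> (L_to_U f) = L_to_U (\<phi> f)" for f by simp
    have "(\<psi> \<circ> L_to_U') f = (L_to_U' \<circ> \<phi>) f" for f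
      by (rule L_alg_hom_eqI[OF alg_hom_comp[OF L_to_U'_hom \<psi>(1)] alg_hom_comp[OF \<phi> L_to_U'_hom]])
        (simp add: \<psi> a_def b_def U_s_def alg_homD[OF \<psi>(1)])
    then show "\<psi> (L_to_U' f) = L_to_U' (\<phi> f)" for f by simp
  qed
qed

lemma U_alg_hom_id_on_L:
  assumes \<psi>: "alg_hom U_scale U_scale \<psi>"
    and l: "\<And>f. \<psi> (L_to_U f) = L_to_U f" and s: "\<And>f. \<psi> (L_to_U' f) = L_to_U' f"
  shows "\<psi> = id"
proof
  have 1: "\<psi> (U_l i) = U_l i" for i
    using l[of "L_var i"] by simp
  have 2: "\<psi> (U_r i) = U_r i" for i
    using s[of "L_var i"] by (simp add: U_s_def alg_homD[OF \<psi>] 1)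
  show "\<psi> u = id u" for u
    by (rule U_alg_hom_eqI[OF \<psi> alg_hom_id[OF vector_space_U_scale]]) (simp_all add: 1 2)
qed

lemma inv_alg_hom:
  assumes "f \<in> algebra_auts s"
  shows "inv_into UNIV f \<in> algebra_auts s"
proof -
  have f: "bij f" "alg_hom s s f"
    using assms by (simp_all add: mem_algebra_auts)
  have vs: "vector_space s"
    using f(2) by (simp add: alg_hom_def Vector_Spaces.linear_iff)
  have inv: "inv_into UNIV f y = x" if "f x = y" for x y
    using that f(1) by (auto simp: bij_is_inj)
  have f_inv: "f (inv_into UNIV f x) = x" for x
    using f(1) by (simp add: bij_is_surj surj_f_inv_f)
  have "alg_hom s s (inv_into UNIV f)"
    by (rule alg_homI) (auto intro!: inv simp: vs alg_homD[OF f(2)] f_inv)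
  then show ?thesis
    using f(1) by (simp add: mem_algebra_auts bij_imp_bij_inv)
qed

text \<open>The lifts of \<open>\<phi>\<close> and of its inverse compose, in either order, to maps
  fixing all l_i and s_i, which generate \<open>U_n\<close>.\<close>

lemma L_aut_lift:
  fixes \<phi> :: "('n::finite, 'k::field) L \<Rightarrow> ('n, 'k) L"
  assumes "\<phi> \<in> algebra_auts pm_scale"
  obtains \<psi> where "\<psi> \<in> algebra_auts U_scale" "\<And>f. \<psi> (L_to_U f) = L_to_U (\<phi> f)"
proof -
  let ?\<phi>' = "inv_into UNIV \<phi>"
  have \<phi>: "bij \<phi>" "alg_hom pm_scale pm_scale \<phi>" and \<phi>': "alg_hom pm_scale pm_scale ?\<phi>'"
    using assms inv_alg_hom[OF assms] by (simp_all add: mem_algebra_auts)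
  have inv: "\<phi> (?\<phi>' f) = f" "?\<phi>' (\<phi> f) = f" for f
    using \<phi>(1) by (simp_all add: bij_is_surj surj_f_inv_f bij_is_inj)
  obtain \<psi> where \<psi>: "alg_hom U_scale U_scale \<psi>"
      "\<And>f. \<psi> (L_to_U f) = L_to_U (\<phi> f)" "\<And>f. \<psi> (L_to_U' f) = L_to_U' (\<phi> f)"
    by (rule L_end_lift[OF \<phi>(2)]) blast
  obtain \<psi>' where \<psi>': "alg_hom U_scale U_scale \<psi>'"
      "\<And>f. \<psi>' (L_to_U f) = L_to_U (?\<phi>' f)" "\<And>f. \<psi>' (L_to_U' f) = L_to_U' (?\<phi>' f)"
    by (rule L_end_lift[OF \<phi>']) blast
  have "\<psi> \<circ> \<psi>' = id" "\<psi>' \<circ> \<psi> = id"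
    by (rule U_alg_hom_id_on_L, rule alg_hom_comp[OF \<psi>'(1) \<psi>(1)] alg_hom_comp[OF \<psi>(1) \<psi>'(1)],
        simp_all add: \<psi> \<psi>' inv)+
  then have "\<psi> \<in> algebra_auts U_scale"
    using \<psi>(1) by (simp add: mem_algebra_auts o_bij)
  with \<psi>(2) that show ?thesis by blast
qed

section \<open>Free algebras over a commutative ring\<close>

text \<open>The coefficients form a commutative ring rather than a field because they will be the
  polynomials in \<open>L_n\<close>.\<close>

definition word_var :: "'n \<Rightarrow> 'n fmonoid \<Rightarrow>\<^sub>0 'c::comm_ring_1"
  where "word_var i = Poly_Mapping.single (FM [i]) 1"

lemma const_commute: "Poly_Mapping.single 0 c * p = p * Poly_Mapping.single 0 c"
  for p :: "'m::monoid_add \<Rightarrow>\<^sub>0 'c::comm_ring_1"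
  by (rule additive_eqI[where F = "\<lambda>p. Poly_Mapping.single 0 c * p"])
    (simp_all add: distrib_left distrib_right mult_single mult.commute)

lemma word_single_Cons:
  "Poly_Mapping.single (FM (i # ws)) c = word_var i * Poly_Mapping.single (FM ws) c"
  by (simp add: word_var_def mult_single plus_fmonoid_def)

lemma word_induct [case_names add const var]:
  fixes p :: "'n fmonoid \<Rightarrow>\<^sub>0 'c::comm_ring_1"
  assumes add: "\<And>p q. P p \<Longrightarrow> P q \<Longrightarrow> P (p + q)"
    and const: "\<And>c. P (Poly_Mapping.single 0 c)" and var: "\<And>i p. P p \<Longrightarrow> P (word_var i * p)"
  shows "P p"
proof (induction p rule: pm_induct)
  case zero
  from const[of 0] show ?case by simp
next
  case (single w)
  have "P (Poly_Mapping.single (FM ws) c)" for ws c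
    using const[of c] by (induction ws) (simp_all add: word_single_Cons var flip: zero_fmonoid_def)
  from this[of "letters w"] show ?case by simp
qed (rule add)

lemma lookup_word_var_mult:
  "Poly_Mapping.lookup (word_var i * p) (FM (j # ws)) = (Poly_Mapping.lookup p (FM ws) when i = j)"
  by (rule additive_eqI[where F = "\<lambda>p. Poly_Mapping.lookup (word_var i * p) (FM (j # ws))"])
    (auto simp: distrib_left lookup_add when_add_distrib word_var_def mult_single lookup_single
      when_def plus_fmonoid_def fmonoid.expand)

lemma lookup_mult_word_var:
  "Poly_Mapping.lookup (p * word_var i) (FM (ws @ [j])) = (Poly_Mapping.lookup p (FM ws) when i = j)"
  by (rule additive_eqI[where F = "\<lambda>p. Poly_Mapping.lookup (p * word_var i) (FM (ws @ [j]))"])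
    (auto simp: distrib_right lookup_add when_add_distrib word_var_def mult_single lookup_single
      when_def plus_fmonoid_def fmonoid.expand)

text \<open>The Leibniz rule for r_i \<mapsto> r_i r_j, unrolled along a word: \<open>j\<close> is
  inserted after each letter in turn.\<close>

fun insertions :: "'n \<Rightarrow> 'n list \<Rightarrow> 'n fmonoid \<Rightarrow>\<^sub>0 'c::comm_ring_1" where
  "insertions j [] = 0"
| "insertions j (i # ws) = Poly_Mapping.single (FM (i # j # ws)) 1 + word_var i * insertions j ws"

text \<open>The coefficient-linear derivation \<open>r\<^sub>i \<mapsto> r\<^sub>i r\<^sub>j\<close>, i.e. the commutator \<open>p \<mapsto> p l\<^sub>j - l\<^sub>j p\<close> in \<open>U\<^sub>n\<close>.\<close>

definition delta :: "'n \<Rightarrow> ('n fmonoid \<Rightarrow>\<^sub>0 'c::comm_ring_1) \<Rightarrow> 'n fmonoid \<Rightarrow>\<^sub>0 'c"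
  where "delta j p = pm_sum (\<lambda>w c. Poly_Mapping.single 0 c * insertions j (letters w)) p"

lemma delta_add: "delta j (p + q) = delta j p + delta j q"
  unfolding delta_def by (rule pm_sum_add) (simp_all add: single_add distrib_right)

lemma delta_single:
  "delta j (Poly_Mapping.single w c) = Poly_Mapping.single 0 c * insertions j (letters w)"
  by (simp add: delta_def)

lemma delta_0 [simp]: "delta j 0 = 0"
  by (simp add: delta_def)

lemma delta_diff: "delta j (p - q) = delta j p - delta j q"
  using delta_add[of j "p - q" q] by simp

lemma delta_const [simp]: "delta j (Poly_Mapping.single 0 c) = 0"
  by (simp add: delta_single zero_fmonoid_def)

lemma delta_const_mult:
  fixes c :: "'c::comm_ring_1" and j :: 'n
  shows "delta j (Poly_Mapping.single 0 c * p) = Poly_Mapping.single 0 c * delta j p"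
proof (rule additive_eqI[where F = "\<lambda>p. delta j (Poly_Mapping.single 0 c * p)"])
  show "delta j (Poly_Mapping.single 0 c * Poly_Mapping.single m d) =
      Poly_Mapping.single 0 c * delta j (Poly_Mapping.single m d)" for m d
  proof -
    have *: "Poly_Mapping.single 0 (c * d) =
        Poly_Mapping.single (0 :: 'n fmonoid) c * Poly_Mapping.single 0 d"
      by (simp add: mult_single)
    then show ?thesis
      by (simp add: mult_single delta_single) (simp only: * mult.assoc)
  qed
qed (simp_all add: delta_add distrib_left)

lemma delta_word_var_mult:
  fixes p :: "'n fmonoid \<Rightarrow>\<^sub>0 'c::comm_ring_1"
  shows "delta j (word_var i * p) = word_var i * (word_var j * p) + word_var i * delta j p"
proof (rule additive_eqI[where F = "\<lambda>p. delta j (word_var i * p)"])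
  fix w :: "'n fmonoid" and c :: 'c
  obtain ws where w: "w = FM ws" by (cases w)
  have "delta j (word_var i * Poly_Mapping.single w c) =
      Poly_Mapping.single 0 c * (Poly_Mapping.single (FM (i # j # ws)) 1 + word_var i * insertions j ws)"
    by (simp add: w delta_single flip: word_single_Cons)
  also have "\<dots> = word_var i * (word_var j * Poly_Mapping.single w c) +
      word_var i * (Poly_Mapping.single 0 c * insertions j ws)"
    by (simp add: distrib_left w mult_single flip: word_single_Cons mult.assoc)
      (simp add: const_commute)
  finally show "delta j (word_var i * Poly_Mapping.single w c) =
      word_var i * (word_var j * Poly_Mapping.single w c) + word_var i * delta j (Poly_Mapping.single w c)"
    by (simp add: w delta_single)
qed (simp_all add: delta_add distrib_left add_ac)

lemma delta_1 [simp]: "delta j 1 = 0"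
  by (metis delta_const single_one)

lemma delta_word_var: "delta j (word_var i) = word_var i * word_var j"
  using delta_word_var_mult[of j i 1] by simp

text \<open>The second-order terms of the Leibniz rule are symmetric in i and j. This is what makes
  the operators of l_i and l_j commute in the action behind \<open>nf\<close>.\<close>

lemma delta_commute: "delta i (delta j p) = delta j (delta i p)"
  by (induction p rule: word_induct)
    (simp_all add: delta_add delta_word_var_mult distrib_left add_ac)


section \<open>Degrees and traces in free algebras\<close>

definition deg_le :: "nat \<Rightarrow> ('n fmonoid \<Rightarrow>\<^sub>0 'c::zero) \<Rightarrow> bool"
  where "deg_le d p \<longleftrightarrow> (\<forall>w. Poly_Mapping.lookup p w \<noteq> 0 \<longrightarrow> length (letters w) \<le> d)"

lemma deg_le_add: "deg_le d p \<Longrightarrow> deg_le d q \<Longrightarrow> deg_le d (p + q)"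
  for p q :: "'n fmonoid \<Rightarrow>\<^sub>0 'c::comm_ring_1"
  unfolding deg_le_def lookup_add by (metis add_0)

lemma deg_le_single: "length (letters w) \<le> d \<Longrightarrow> deg_le d (Poly_Mapping.single w c)"
  by (auto simp: deg_le_def lookup_single when_def)

lemma deg_le_mult:
  fixes p q :: "'n fmonoid \<Rightarrow>\<^sub>0 'c::comm_ring_1"
  assumes "deg_le d p" "deg_le e q"
  shows "deg_le (d + e) (p * q)"
proof -
  have "length (letters w) \<le> d + e" if w: "w \<in> Poly_Mapping.keys (p * q)" for w
  proof -
    obtain u v where "w = u + v" "u \<in> Poly_Mapping.keys p" "v \<in> Poly_Mapping.keys q"
      using keys_mult[of p q] w by blast
    then show ?thesis
      using assms by (fastforce simp: deg_le_def in_keys_iff plus_fmonoid_def)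
  qed
  then show ?thesis
    by (auto simp: deg_le_def in_keys_iff)
qed

lemma deg_le_power: "deg_le d p \<Longrightarrow> deg_le (k * d) (p ^ k)"
  for p :: "'n fmonoid \<Rightarrow>\<^sub>0 'c::comm_ring_1"
proof (induction k)
  case 0
  have "deg_le 0 (Poly_Mapping.single (0 :: 'n fmonoid) (1 :: 'c))"
    by (rule deg_le_single) (simp add: zero_fmonoid_def)
  then show ?case by simp
qed (simp add: deg_le_mult)

lemma deg_le_delta:
  fixes p :: "'n fmonoid \<Rightarrow>\<^sub>0 'c::comm_ring_1"
  assumes "deg_le d p"
  shows "deg_le (d + 1) (delta j p)"
proof (induction p rule: pm_induct)
  case (single w)
  have "deg_le (length ws + 1) (insertions j ws :: 'n fmonoid \<Rightarrow>\<^sub>0 'c)" for ws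
  proof (induction ws)
    case (Cons i ws)
    have "deg_le 1 (word_var i :: 'n fmonoid \<Rightarrow>\<^sub>0 'c)"
      by (simp add: word_var_def deg_le_single)
    from deg_le_mult[OF this Cons] show ?case
      by (simp add: deg_le_add deg_le_single)
  qed (simp add: deg_le_def)
  from deg_le_mult[OF deg_le_single[of 0 0] this]
  have "deg_le (length (letters w) + 1) (delta j (Poly_Mapping.single w (Poly_Mapping.lookup p w)))"
    by (simp add: delta_single zero_fmonoid_def)
  moreover have "length (letters w) \<le> d"
    using assms single by (simp add: deg_le_def)
  ultimately show ?case
    unfolding deg_le_def by (meson add_le_mono1 le_trans)
qed (simp_all add: deg_le_add delta_add deg_le_def[of _ 0])

text \<open>Under the degree bounds \<open>u @ v\<close> arises only by joining words of the full
  lengths of \<open>u\<close> and \<open>v\<close>, and the cut at that place is unique.\<close>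

lemma lookup_mult_top:
  fixes p q :: "'n fmonoid \<Rightarrow>\<^sub>0 'c::comm_ring_1"
  assumes "deg_le (length u) p" "deg_le (length v) q"
  shows "Poly_Mapping.lookup (p * q) (FM (u @ v)) =
    Poly_Mapping.lookup p (FM u) * Poly_Mapping.lookup q (FM v)"
proof (induction p rule: pm_induct)
  case (single m)
  then have m: "length (letters m) \<le> length u"
    using assms(1) by (simp add: deg_le_def)
  show ?case
  proof (induction q rule: pm_induct)
    case (single n)
    then have n: "length (letters n) \<le> length v"
      using assms(2) by (simp add: deg_le_def)
    have "m + n = FM (u @ v) \<longleftrightarrow> m = FM u \<and> n = FM v"
    proof
      assume "m + n = FM (u @ v)"
      then have *: "letters m @ letters n = u @ v"
        by (simp add: plus_fmonoid_def)
      have "length (letters m) + length (letters n) = length u + length v"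
        using arg_cong[OF *, of length] by (simp only: length_append)
      with m n have "length (letters m) = length u"
        by simp
      with * show "m = FM u \<and> n = FM v"
        by (cases m; cases n) simp
    qed (simp add: plus_fmonoid_def)
    then show ?case
      by (auto simp: mult_single lookup_single when_def)
  qed (simp_all add: distrib_left lookup_add)
qed (simp_all add: distrib_right lookup_add)

lemma lookup_power_top:
  fixes p :: "'n fmonoid \<Rightarrow>\<^sub>0 'c::comm_ring_1"
  assumes "deg_le (length u) p"
  shows "Poly_Mapping.lookup (p ^ k) (FM (concat (replicate k u))) = Poly_Mapping.lookup p (FM u) ^ k"
proof (induction k)
  case 0
  then show ?case by (simp flip: zero_fmonoid_def)
next
  case (Suc k)
  have "deg_le (length (concat (replicate k u))) (p ^ k)"
    using deg_le_power[OF assms, of k] by (simp add: length_concat sum_list_replicate)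
  with Suc assms show ?case
    by (simp add: lookup_mult_top)
qed

section \<open>Cyclic words and traces\<close>

definition rotations :: "'a list \<Rightarrow> 'a list set"
  where "rotations w = range (\<lambda>n. rotate n w)"

lemma rotations_swap: "u @ v \<in> rotations w \<Longrightarrow> v @ u \<in> rotations w"
proof -
  assume "u @ v \<in> rotations w"
  then obtain n where "u @ v = rotate n w"
    by (auto simp: rotations_def)
  then have "v @ u = rotate (length u + n) w"
    by (metis rotate_append rotate_rotate)
  then show ?thesis
    by (auto simp: rotations_def)
qed

lemma finite_rotations: "finite (rotations w)"
proof -
  have "rotations w \<subseteq> insert w ((\<lambda>n. rotate n w) ` {..<length w})"
  proof
    fix v assume "v \<in> rotations w"
    then obtain n where "v = rotate (n mod length w) w"
      unfolding rotations_def by (metis rangeE rotate_conv_mod)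
    then show "v \<in> insert w ((\<lambda>n. rotate n w) ` {..<length w})"
      by (cases "w = []") auto
  qed
  then show ?thesis
    by (rule finite_subset) simp
qed

lemma rotate_concat_replicate:
  "rotate n (concat (replicate k u)) = concat (replicate k (rotate n u))"
proof (induction n)
  case (Suc n)
  have "concat (replicate k (a # v)) @ [a] = a # concat (replicate k (v @ [a]))" for a :: 'a and v
    by (induction k) simp_all
  then have "rotate1 (concat (replicate k v)) = concat (replicate k (rotate1 v))" for v :: "'a list"
    by (cases k; cases v) (simp_all add: concat_replicate_trivial)
  with Suc show ?case by simp
qed simp

lemma rotations_concat_replicate:
  "rotations (concat (replicate k u)) = (\<lambda>v. concat (replicate k v)) ` rotations u"
  by (auto simp: rotations_def rotate_concat_replicate)

text \<open>The trace functional of a cyclic word. As \<open>rotations w\<close> is a set, each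
  distinct rotation counts once, even when \<open>w\<close> is periodic.\<close>

definition word_trace :: "'n list \<Rightarrow> ('n fmonoid \<Rightarrow>\<^sub>0 'c::comm_ring_1) \<Rightarrow> 'c"
  where "word_trace w p = (\<Sum>v\<in>rotations w. Poly_Mapping.lookup p (FM v))"

lemma word_trace_add: "word_trace w (p + q) = word_trace w p + word_trace w q"
  by (simp add: word_trace_def lookup_add sum.distrib)

lemma word_trace_diff: "word_trace w (p - q) = word_trace w p - word_trace w q"
  by (simp add: word_trace_def lookup_minus sum_subtractf)

text \<open>By bilinearity it is enough to treat words, and \<open>u @ v\<close> and
  \<open>v @ u\<close> are rotations of each other.\<close>

lemma word_trace_mult_commute:
  fixes p q :: "'n fmonoid \<Rightarrow>\<^sub>0 'c::comm_ring_1"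
  shows "word_trace w (p * q) = word_trace w (q * p)"
proof (rule additive_eqI[where F = "\<lambda>p. word_trace w (p * q)"])
  show "word_trace w (Poly_Mapping.single m c * q) = word_trace w (q * Poly_Mapping.single m c)"
    for m c
  proof (rule additive_eqI[where F = "\<lambda>q. word_trace w (Poly_Mapping.single m c * q)"])
    fix n d
    have *: "word_trace w (Poly_Mapping.single v a) = (a when letters v \<in> rotations w)"
      for v a
    proof -
      have "word_trace w (Poly_Mapping.single v a) =
          (\<Sum>u\<in>rotations w. if u = letters v then a else 0)"
        unfolding word_trace_def by (rule sum.cong) (auto simp: lookup_single when_def)
      then show ?thesis
        by (simp add: finite_rotations)
    qed
    show "word_trace w (Poly_Mapping.single m c * Poly_Mapping.single n d) =
        word_trace w (Poly_Mapping.single n d * Poly_Mapping.single m c)"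
      using rotations_swap[of "letters m" "letters n" w] rotations_swap[of "letters n" "letters m" w]
      by (auto simp: mult_single * mult.commute plus_fmonoid_def when_def)
  qed (simp_all add: distrib_left distrib_right word_trace_add)
qed (simp_all add: distrib_left distrib_right word_trace_add)

text \<open>Rotation commutes with repeating a word, so the cyclic class of the k-th power of
  \<open>u\<close> consists of k-th powers of rotations of \<open>u\<close>. Traces of powers thus
  become power sums of top coefficients; \<open>k > 0\<close> keeps distinct rotations
  distinct.\<close>

lemma word_trace_power_top:
  fixes p :: "'n fmonoid \<Rightarrow>\<^sub>0 'c::comm_ring_1"
  assumes "deg_le (length u) p" "k > 0"
  shows "word_trace (concat (replicate k u)) (p ^ k) = (\<Sum>v\<in>rotations u. Poly_Mapping.lookup p (FM v) ^ k)"
proof -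
  have len: "length v = length u" if "v \<in> rotations u" for v
    using that by (auto simp: rotations_def)
  have "inj_on (\<lambda>v. concat (replicate k v)) (rotations u)"
  proof (rule inj_onI)
    fix v v' assume "v \<in> rotations u" "v' \<in> rotations u"
      and "concat (replicate k v) = concat (replicate k v')"
    with \<open>k > 0\<close> show "v = v'"
      using len by (cases k) auto
  qed
  then show ?thesis
    using assms(1) len
    by (simp add: word_trace_def rotations_concat_replicate sum.reindex lookup_power_top)
qed

text \<open>A polynomial vanishing at all values other than \<open>f v\<close> isolates the number
  of times \<open>f v\<close> is attained, which is nonzero in characteristic 0.\<close>

lemma power_sums_eq_0:
  fixes f :: "'a \<Rightarrow> 'c::{comm_ring_1, ring_char_0}"
  assumes nzd: "\<And>x y :: 'c. x * y = 0 \<Longrightarrow> x = 0 \<or> y = 0"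
    and "finite S" and sums: "\<And>k. k \<ge> 2 \<Longrightarrow> (\<Sum>v\<in>S. f v ^ k) = 0" and "v \<in> S"
  shows "f v = 0"
proof (rule ccontr)
  assume "f v \<noteq> 0"
  \<comment> \<open>The factor \<open>f u ^ 2\<close> is there because the power sums are known to
    vanish only from \<open>k = 2\<close> on.\<close>
  have sum_poly: "(\<Sum>u\<in>S. f u ^ 2 * poly q (f u)) = 0" for q
  proof -
    have "(\<Sum>u\<in>S. f u ^ 2 * poly q (f u)) = (\<Sum>u\<in>S. \<Sum>i\<le>degree q. coeff q i * f u ^ (i + 2))"
      by (simp only: poly_altdef sum_distrib_left power_add ac_simps)
    also have "\<dots> = (\<Sum>i\<le>degree q. coeff q i * (\<Sum>u\<in>S. f u ^ (i + 2)))"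
      by (subst sum.swap) (simp only: sum_distrib_left)
    finally show ?thesis
      by (simp add: sums del: power_Suc power_Suc2 add_2_eq_Suc')
  qed
  define Z where "Z = f ` S - {f v}"
  define q where "q = (\<Prod>z\<in>Z. [:-z, 1:])"
  have "finite Z"
    using \<open>finite S\<close> by (simp add: Z_def)
  have poly_q: "poly q x = (\<Prod>z\<in>Z. x - z)" for x
    by (simp add: q_def poly_prod)
  have prod_nz: "(\<Prod>z\<in>Y. f v - z) \<noteq> 0" if "finite Y" "f v \<notin> Y" for Y
    using that by (induction Y rule: finite_induct) (auto dest: nzd)
  have "0 = (\<Sum>u\<in>S. f u ^ 2 * poly q (f u))"
    by (simp add: sum_poly)
  also have "\<dots> = (\<Sum>u\<in>S. if f u = f v then f v ^ 2 * poly q (f v) else 0)"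
  proof (rule sum.cong)
    show "f u ^ 2 * poly q (f u) = (if f u = f v then f v ^ 2 * poly q (f v) else 0)" if "u \<in> S" for u
    proof (cases "f u = f v")
      case False
      with that have "f u \<in> Z" by (simp add: Z_def)
      then have "poly q (f u) = 0"
        unfolding poly_q using \<open>finite Z\<close> by (intro prod_zero) auto
      with False show ?thesis by simp
    qed simp
  qed simp
  also have "\<dots> = of_nat (card {u\<in>S. f u = f v}) * (f v ^ 2 * poly q (f v))"
    using \<open>finite S\<close> by (simp add: sum.If_cases Int_def conj_commute)
  finally have "of_nat (card {u\<in>S. f u = f v}) * (f v ^ 2 * poly q (f v)) = 0" by simp
  moreover have "card {u\<in>S. f u = f v} \<noteq> 0"
    using \<open>finite S\<close> \<open>v \<in> S\<close> by auto
  moreover have "poly q (f v) \<noteq> 0"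
    unfolding poly_q using \<open>finite Z\<close> by (rule prod_nz) (simp add: Z_def)
  ultimately show False
    using \<open>f v \<noteq> 0\<close> by (auto dest!: nzd simp: power2_eq_square)
qed

text \<open>
  Multiplying the hypothesis by \<open>R ^ (k - 2)\<close> and taking traces kills the commutator, while
  \<open>delta j\<close> raises the degree only by one; so if \<open>R\<close> had degree at least two, the \<open>k\<close>-th powers of its
  leading form would have trace zero for all \<open>k \<ge> 2\<close>.
\<close>

lemma twisted_square_deg_le_1:
  fixes R e :: "'n fmonoid \<Rightarrow>\<^sub>0 'c::{comm_ring_1, ring_char_0}"
  assumes nzd: "\<And>x y :: 'c. x * y = 0 \<Longrightarrow> x = 0 \<or> y = 0"
    and eq: "delta j R + R * e - e * R = R * R"
  shows "deg_le 1 R"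
proof (rule ccontr)
  assume "\<not> deg_le 1 R"
  then obtain w where w: "w \<in> Poly_Mapping.keys R" "length (letters w) > 1"
    by (auto simp: deg_le_def in_keys_iff)
  define d where "d = Max ((\<lambda>w. length (letters w)) ` Poly_Mapping.keys R)"
  have "deg_le d R"
    by (auto simp: deg_le_def d_def in_keys_iff intro!: Max_ge)
  have "d > 1"
    using \<open>deg_le d R\<close> w by (force simp: deg_le_def in_keys_iff)
  have "d \<in> (\<lambda>w. length (letters w)) ` Poly_Mapping.keys R"
    unfolding d_def using w by (intro Max_in) auto
  then obtain u where u: "length u = d" "Poly_Mapping.lookup R (FM u) \<noteq> 0"
    by (auto simp: in_keys_iff)
  have sums: "(\<Sum>v\<in>rotations u. Poly_Mapping.lookup R (FM v) ^ k) = 0"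
    if k2: "k \<ge> 2" for k
  proof -
    obtain m where k: "k = m + 2"
      using le_Suc_ex[OF k2] by (auto simp: add.commute)
    let ?W = "concat (replicate k u)"
    have "deg_le (m * d + (d + 1)) (R ^ m * delta j R)"
      by (intro deg_le_mult deg_le_power deg_le_delta \<open>deg_le d R\<close>)
    \<comment> \<open>Here \<open>d > 1\<close> enters: \<open>(m + 2) * d\<close> exceeds
      \<open>m * d + (d + 1)\<close>.\<close>
    moreover have "m * d + (d + 1) < length v" if "v \<in> rotations ?W" for v
    proof -
      have "length v = k * d"
        using that by (auto simp: rotations_def length_concat sum_list_replicate u)
      then show ?thesis
        using \<open>d > 1\<close> by (simp add: k add_mult_distrib)
    qed
    ultimately have "word_trace ?W (R ^ m * delta j R) = 0"
      unfolding word_trace_def deg_le_def by (intro sum.neutral ballI) (metis fmonoid.sel leD)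
    \<comment> \<open>As \<open>R ^ m\<close> commutes with \<open>R\<close>, it can be absorbed
      into \<open>e\<close>, leaving the commutator of \<open>R\<close> and
      \<open>R ^ m * e\<close>.\<close>
    moreover have "R ^ k = R ^ m * delta j R + R * (R ^ m * e) - R ^ m * e * R"
    proof -
      have "R ^ k = R ^ m * (delta j R + R * e - e * R)"
        unfolding eq k by (simp only: power_add power2_eq_square)
      also have "\<dots> = R ^ m * delta j R + R ^ m * R * e - R ^ m * e * R"
        by (simp add: distrib_left right_diff_distrib mult.assoc)
      finally show ?thesis
        by (simp add: power_commutes mult.assoc)
    qed
    ultimately have "word_trace ?W (R ^ k) = 0"
      by (simp add: word_trace_add word_trace_diff word_trace_mult_commute[of _ R])
    with u \<open>deg_le d R\<close> k2 show ?thesis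
      by (simp add: word_trace_power_top)
  qed
  have "u \<in> rotations u"
    unfolding rotations_def by (rule range_eqI[of _ _ 0]) simp
  from power_sums_eq_0[OF nzd finite_rotations sums this]
  have "Poly_Mapping.lookup R (FM u) = 0" .
  with u show False by simp
qed

text \<open>Commuting with the variable \<open>k\<close> forces every nonempty word of
  \<open>e\<close> to end in \<open>k\<close>, by comparing coefficients at the word with
  \<open>k\<close> put in front. Two different variables cannot both be the last letter.\<close>

lemma word_vars_centralizer:
  fixes e :: "'n fmonoid \<Rightarrow>\<^sub>0 'c::comm_ring_1"
  assumes "i \<noteq> j" and "Poly_Mapping.lookup e 0 = 0"
    and i: "word_var i * e = e * word_var i" and j: "word_var j * e = e * word_var j"
  shows "e = 0"
proof (rule ccontr)
  assume "e \<noteq> 0"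
  then obtain w where w: "Poly_Mapping.lookup e w \<noteq> 0"
    by (metis lookup_zero poly_mapping_eqI)
  with assms(2) obtain ws m where ws: "w = FM (ws @ [m])"
    by (cases w) (metis fmonoid.sel rev_exhaust zero_fmonoid_def)
  have "m = k" if "word_var k * e = e * word_var k" for k
  proof -
    have "Poly_Mapping.lookup e w = Poly_Mapping.lookup (word_var k * e) (FM (k # ws @ [m]))"
      by (simp add: ws lookup_word_var_mult)
    also have "\<dots> = Poly_Mapping.lookup (e * word_var k) (FM ((k # ws) @ [m]))"
      by (simp add: that)
    finally show ?thesis
      using w by (auto simp only: lookup_mult_word_var when_def split: if_splits)
  qed
  from this[OF i] this[OF j] \<open>i \<noteq> j\<close> show False by simp
qed

section \<open>Normal forms in \<open>U\<^sub>n\<close>\<close>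

lemma letters_0 [simp]: "letters 0 = []"
  by (simp add: zero_fmonoid_def)

lemma lookup_const_mult:
  fixes p :: "'m::monoid_add \<Rightarrow>\<^sub>0 'c::comm_ring_1"
  shows "Poly_Mapping.lookup (Poly_Mapping.single 0 c * p) w = c * Poly_Mapping.lookup p w"
  by (rule additive_eqI[where F = "\<lambda>p. Poly_Mapping.lookup (Poly_Mapping.single 0 c * p) w"])
    (auto simp: distrib_left lookup_add mult_single lookup_single when_def)

lemma const_left_commute:
  fixes p :: "'m::monoid_add \<Rightarrow>\<^sub>0 'c::comm_ring_1"
  shows "Poly_Mapping.single 0 c * (Poly_Mapping.single 0 d * p) =
    Poly_Mapping.single 0 d * (Poly_Mapping.single 0 c * p)"
  by (simp add: mult_single mult.commute flip: mult.assoc)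

lemma word_var_const_commute:
  "word_var i * (Poly_Mapping.single 0 c * p) = Poly_Mapping.single 0 c * (word_var i * p)"
  by (metis const_commute mult.assoc)

lemma lookup_word_var_mult_0 [simp]: "Poly_Mapping.lookup (word_var i * p) 0 = 0"
  by (rule additive_eqI[where F = "\<lambda>p. Poly_Mapping.lookup (word_var i * p) 0"])
    (auto simp: distrib_left lookup_add word_var_def mult_single lookup_single
      when_def plus_fmonoid_def zero_fmonoid_def)

lemma lookup_delta_0 [simp]: "Poly_Mapping.lookup (delta j p) 0 = 0"
  by (induction p rule: word_induct)
    (simp_all add: delta_add lookup_add delta_word_var_mult)

text \<open>
  \<open>U\<^sub>n\<close> acts on \<open>L\<^sub>n \<otimes> K\<langle>r\<^sub>1,\<dots>,r\<^sub>n\<rangle>\<close>: \<open>r\<^sub>i\<close> by left multiplication and \<open>l\<^sub>j\<close> by \<open>l\<^sub>j - delta j\<close>; \<open>nf u\<close> is the image of 1 under \<open>u\<close>, so that \<open>nf (r\<^sub>w l\<^sup>a) = l\<^sup>a r\<^sub>w\<close>.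
\<close>

definition nf :: "('n::finite, 'k::field) U \<Rightarrow> 'n fmonoid \<Rightarrow>\<^sub>0 ('n, 'k) L"
  where "nf = (SOME N.
    (\<forall>u v. N (u + v) = N u + N v) \<and>
    (\<forall>c u. N (U_scale c u) = Poly_Mapping.single 0 (Poly_Mapping.single 0 c) * N u) \<and> N 1 = 1 \<and>
    (\<forall>j u. N (U_l j * u) = Poly_Mapping.single 0 (L_var j) * N u - delta j (N u)) \<and>
    (\<forall>i u. N (U_r i * u) = word_var i * N u))"

lemma nf_add: "nf (u + v) = nf u + nf v"
  and nf_scale: "nf (U_scale c u) = Poly_Mapping.single 0 (Poly_Mapping.single 0 c) * nf u"
  and nf_1 [simp]: "nf (1 :: ('n, 'k) U) = 1"
  and nf_l_mult: "nf (U_l j * u) = Poly_Mapping.single 0 (L_var j) * nf u - delta j (nf u)"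
  and nf_r_mult: "nf (U_r i * u) = word_var i * nf u"
  for u v :: "('n::finite, 'k::field) U"
proof -
  define s where "s c p = Poly_Mapping.single 0 (Poly_Mapping.single 0 c) * p"
    for c :: 'k and p :: "'n fmonoid \<Rightarrow>\<^sub>0 ('n, 'k) L"
  define T where "T g p = (case g of
      Lgen j \<Rightarrow> Poly_Mapping.single 0 (L_var j) * p - delta j p | Rgen i \<Rightarrow> word_var i * p)"
    for g and p :: "'n fmonoid \<Rightarrow>\<^sub>0 ('n, 'k) L"
  have "vector_space s"
    by unfold_locales (simp_all add: s_def distrib_left distrib_right single_add mult_single flip: mult.assoc)
  moreover have "T g (p + q) = T g p + T g q" for g p q
    by (simp add: T_def distrib_left delta_add split: gen.split)
  moreover have "T g (s c p) = s c (T g p)" for g c p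
    by (simp add: T_def s_def delta_const_mult right_diff_distrib const_left_commute
        word_var_const_commute split: gen.split)
  ultimately have lin: "Vector_Spaces.linear s s (T g)" for g
    by (simp add: Vector_Spaces.linear_iff)
  have ll: "T (Lgen i) (T (Lgen j) p) = T (Lgen j) (T (Lgen i) p)" for i j p
    by (simp add: T_def delta_diff delta_const_mult right_diff_distrib delta_commute[of i j]
        const_left_commute)
  \<comment> \<open>The first term of \<open>delta_word_var_mult\<close> accounts for the summand
    r_i r_j of the relation.\<close>
  have rl: "T (Rgen i) (T (Lgen j) p) = T (Lgen j) (T (Rgen i) p) + T (Rgen i) (T (Rgen j) p)" for i j p
    by (simp add: T_def right_diff_distrib delta_word_var_mult word_var_const_commute)
  obtain \<rho> where \<rho>: "\<And>u v p. \<rho> (u + v) p = \<rho> u p + \<rho> v p"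
      "\<And>c u p. \<rho> (U_scale c u) p = s c (\<rho> u p)"
      "\<And>p. \<rho> 1 p = p" "\<And>u v p. \<rho> (u * v) p = \<rho> u (\<rho> v p)"
      "\<And>i. \<rho> (U_l i) = T (Lgen i)" "\<And>i. \<rho> (U_r i) = T (Rgen i)"
    by (rule U_rep_exists[OF lin ll rl]) blast
  have "\<exists>N :: ('n, 'k) U \<Rightarrow> 'n fmonoid \<Rightarrow>\<^sub>0 ('n, 'k) L.
    (\<forall>u v. N (u + v) = N u + N v) \<and>
    (\<forall>c u. N (U_scale c u) = Poly_Mapping.single 0 (Poly_Mapping.single 0 c) * N u) \<and> N 1 = 1 \<and>
    (\<forall>j u. N (U_l j * u) = Poly_Mapping.single 0 (L_var j) * N u - delta j (N u)) \<and>
    (\<forall>i u. N (U_r i * u) = word_var i * N u)"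
    by (rule exI[of _ "\<lambda>u. \<rho> u 1"]) (simp add: \<rho> s_def T_def)
  from someI_ex[OF this, folded nf_def]
  show "nf (u + v) = nf u + nf v"
    "nf (U_scale c u) = Poly_Mapping.single 0 (Poly_Mapping.single 0 c) * nf u" "nf (1 :: ('n, 'k) U) = 1"
    "nf (U_l j * u) = Poly_Mapping.single 0 (L_var j) * nf u - delta j (nf u)"
    "nf (U_r i * u) = word_var i * nf u"
    by blast+
qed

lemma nf_0 [simp]: "nf 0 = 0"
  using nf_add[of 0 0] by simp

lemma nf_sum: "nf (sum f A) = (\<Sum>i\<in>A. nf (f i))"
  by (induction A rule: infinite_finite_induct) (simp_all add: nf_add)

lemma nf_l: "nf (U_l j) = Poly_Mapping.single 0 (L_var j)"
  using nf_l_mult[of j 1] by simp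

lemma nf_r: "nf (U_r i) = word_var i"
  using nf_r_mult[of i 1] by simp

text \<open>Multiplication by the variable commutes with every operator of the action, so l_j on the
  right produces no \<open>delta\<close> term. Compared with \<open>nf_l_mult\<close>, taking the
  commutator with l_j becomes \<open>delta j\<close>.\<close>

lemma nf_mult_l: "nf (u * U_l j) = Poly_Mapping.single 0 (L_var j) * nf u"
proof (induction u rule: U_induct)
  case (const c)
  then show ?case
    by (simp add: U_scale_mult_left nf_scale nf_l mult_single mult.commute)
next
  case (l i u)
  then show ?case
    by (simp add: mult.assoc nf_l_mult delta_const_mult right_diff_distrib const_left_commute)
next
  case (r i u)
  then show ?case
    by (simp add: mult.assoc nf_r_mult word_var_const_commute)
qed (simp add: nf_add distrib_left distrib_right)

lemma U_to_L_conv_nf: "U_to_L u = Poly_Mapping.lookup (nf u) 0"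
  by (induction u rule: U_induct)
    (simp_all add: alg_homD[OF U_to_L_hom] nf_add nf_scale nf_l_mult nf_r_mult lookup_add
      lookup_minus lookup_const_mult pm_scale_conv_mult)

section \<open>Recovering an element from its normal form\<close>

definition of_nf :: "('n fmonoid \<Rightarrow>\<^sub>0 ('n, 'k) L) \<Rightarrow> ('n::finite, 'k::field) U"
  where "of_nf = pm_sum (\<lambda>w f. (\<Prod>i\<leftarrow>letters w. U_r i) * L_to_U f)"

lemma of_nf_add: "of_nf (p + q) = of_nf p + of_nf q"
  unfolding of_nf_def
  by (rule pm_sum_add) (simp_all add: alg_homD[OF L_to_U_hom] distrib_left)

lemma of_nf_0 [simp]: "of_nf 0 = 0"
  by (simp add: of_nf_def)

lemma of_nf_single: "of_nf (Poly_Mapping.single w f) = (\<Prod>i\<leftarrow>letters w. U_r i) * L_to_U f"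
  unfolding of_nf_def by (rule pm_sum_single) (simp add: alg_homD[OF L_to_U_hom])

lemma of_nf_diff: "of_nf (p - q) = of_nf p - of_nf q"
  using of_nf_add[of "p - q" q] by simp

lemma of_nf_var_mult: "of_nf (word_var i * p) = U_r i * of_nf p"
  by (rule additive_eqI[where F = "\<lambda>p. of_nf (word_var i * p)"])
    (simp_all add: of_nf_add distrib_left of_nf_single word_var_def mult_single plus_fmonoid_def
      mult.assoc)

text \<open>Moving l_j past the letters r_i by \<open>U_r_l\<close> produces exactly the terms of
  \<open>delta j\<close>.\<close>

lemma of_nf_l: "of_nf (Poly_Mapping.single 0 (L_var j) * p - delta j p) = U_l j * of_nf p"
proof (induction p rule: word_induct)
  case (add p q)
  have "Poly_Mapping.single 0 (L_var j) * (p + q) - delta j (p + q) =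
      (Poly_Mapping.single 0 (L_var j) * p - delta j p) + (Poly_Mapping.single 0 (L_var j) * q - delta j q)"
    by (simp add: distrib_left delta_add)
  then show ?case
    by (simp only: of_nf_add add distrib_left)
next
  case (const f)
  then show ?case
    by (simp add: mult_single of_nf_single alg_homD[OF L_to_U_hom])
next
  case (var i p)
  have "Poly_Mapping.single 0 (L_var j) * (word_var i * p) - delta j (word_var i * p) =
      word_var i * (Poly_Mapping.single 0 (L_var j) * p - delta j p) - word_var i * (word_var j * p)"
    by (simp add: delta_word_var_mult right_diff_distrib word_var_const_commute)
  also have "of_nf \<dots> = U_r i * U_l j * of_nf p - U_r i * U_r j * of_nf p"
    by (simp only: of_nf_diff[of "word_var i * _"] of_nf_var_mult var mult.assoc)
  also have "\<dots> = U_l j * (U_r i * of_nf p)"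
    by (simp add: U_r_l distrib_right mult.assoc)
  finally show ?case
    by (simp add: of_nf_var_mult)
qed

text \<open>\<open>of_nf\<close> turns the action on normal forms into left multiplication and sends
  1 to 1. Hence \<open>nf\<close> is injective.\<close>

lemma of_nf_nf [simp]: "of_nf (nf u) = u"
proof (induction u rule: U_induct)
  case (const c)
  have "L_to_U (Poly_Mapping.single 0 c :: ('a, 'b) L) = U_scale c 1"
    using alg_homD(2)[OF L_to_U_hom, of c 1] by (simp add: pm_scale_conv_mult alg_homD[OF L_to_U_hom])
  then show ?case
    by (simp add: nf_scale of_nf_single zero_fmonoid_def)
qed (simp_all add: nf_add of_nf_add nf_l_mult of_nf_l nf_r_mult of_nf_var_mult)

lemma nf_inject: "nf u = nf v \<longleftrightarrow> u = v"
  by (metis of_nf_nf)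


section \<open>Leading forms\<close>

definition exp_degree :: "('n::finite \<Rightarrow>\<^sub>0 nat) \<Rightarrow> nat"
  where "exp_degree a = (\<Sum>i\<in>UNIV. Poly_Mapping.lookup a i)"

lemma exp_degree_add: "exp_degree (a + b) = exp_degree a + exp_degree b"
  by (simp add: exp_degree_def lookup_add sum.distrib)

lemma exp_degree_0 [simp]: "exp_degree 0 = 0"
  by (simp add: exp_degree_def)

lemma exp_degree_single [simp]: "exp_degree (Poly_Mapping.single i k) = k"
proof -
  have "exp_degree (Poly_Mapping.single i k) = (\<Sum>j\<in>UNIV. if j = i then k else 0)"
    unfolding exp_degree_def by (rule sum.cong) (auto simp: lookup_single when_def)
  then show ?thesis by simp
qed

lemma nested_induct [case_names zero add single]:
  fixes p :: "'m \<Rightarrow>\<^sub>0 'l \<Rightarrow>\<^sub>0 'c::comm_monoid_add"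
  assumes zero: "P 0" and add: "\<And>p q. P p \<Longrightarrow> P q \<Longrightarrow> P (p + q)"
    and single: "\<And>m a. Poly_Mapping.lookup (Poly_Mapping.lookup p m) a \<noteq> 0 \<Longrightarrow>
      P (Poly_Mapping.single m (Poly_Mapping.single a (Poly_Mapping.lookup (Poly_Mapping.lookup p m) a)))"
  shows "P p"
proof (induction p rule: pm_induct)
  case (single m)
  show ?case
    by (rule pm_induct[where p = "Poly_Mapping.lookup p m" and P = "\<lambda>f. P (Poly_Mapping.single m f)"])
      (simp_all add: zero single_add add assms(3))
qed (simp_all add: zero add)

text \<open>
  Monomials \<open>l\<^sup>a r\<^sub>w\<close> are weighted by \<open>\<alpha>\<close> for each \<open>l\<^sub>i\<close> and \<open>\<beta>\<close> for each \<open>r\<^sub>i\<close>. As \<open>\<beta> < \<alpha>\<close>, the term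
  \<open>r\<^sub>i r\<^sub>j\<close> is negligible in \<open>r\<^sub>i l\<^sub>j = l\<^sub>j r\<^sub>i + r\<^sub>i r\<^sub>j\<close>, so the \<open>l\<^sub>j\<close> become central in the associated graded algebra.
\<close>

locale weights =
  fixes \<alpha> \<beta> :: real and ty :: "('n::finite \<times> 'k::field) itself"
  assumes \<beta>_less_\<alpha>: "\<beta> < \<alpha>"
begin

definition wt :: "'n fmonoid \<Rightarrow> ('n \<Rightarrow>\<^sub>0 nat) \<Rightarrow> real"
  where "wt w a = \<alpha> * real (exp_degree a) + \<beta> * real (length (letters w))"

definition homogeneous :: "real \<Rightarrow> ('n fmonoid \<Rightarrow>\<^sub>0 ('n, 'k) L) \<Rightarrow> bool"
  where "homogeneous s p \<longleftrightarrow>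
    (\<forall>w a. Poly_Mapping.lookup (Poly_Mapping.lookup p w) a \<noteq> 0 \<longrightarrow> wt w a = s)"

definition below :: "real \<Rightarrow> ('n fmonoid \<Rightarrow>\<^sub>0 ('n, 'k) L) \<Rightarrow> bool"
  where "below s p \<longleftrightarrow>
    (\<forall>w a. Poly_Mapping.lookup (Poly_Mapping.lookup p w) a \<noteq> 0 \<longrightarrow> wt w a < s)"

text \<open>\<open>q\<close> may be 0, so \<open>s\<close> is only an upper bound for the weight of
  \<open>p\<close>; elements of different weights can then be compared at one common
  \<open>s\<close>.\<close>

definition leading :: "real \<Rightarrow> ('n fmonoid \<Rightarrow>\<^sub>0 ('n, 'k) L) \<Rightarrow> ('n fmonoid \<Rightarrow>\<^sub>0 ('n, 'k) L) \<Rightarrow> bool"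
  where "leading s p q \<longleftrightarrow> homogeneous s q \<and> below s (p - q)"

lemma homogeneous_0 [simp]: "homogeneous s 0"
  by (simp add: homogeneous_def)

lemma below_0 [simp]: "below s 0"
  by (simp add: below_def)

lemma homogeneous_add: "homogeneous s p \<Longrightarrow> homogeneous s q \<Longrightarrow> homogeneous s (p + q)"
  unfolding homogeneous_def lookup_add by (metis add_0)

lemma homogeneous_diff: "homogeneous s p \<Longrightarrow> homogeneous s q \<Longrightarrow> homogeneous s (p - q)"
  unfolding homogeneous_def lookup_minus by (metis diff_0_right)

lemma below_add: "below s p \<Longrightarrow> below s q \<Longrightarrow> below s (p + q)"
  unfolding below_def lookup_add by (metis add_0)

lemma below_diff: "below s p \<Longrightarrow> below s q \<Longrightarrow> below s (p - q)"
  unfolding below_def lookup_minus by (metis diff_0_right)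

lemma homogeneous_monomial:
  "wt w a = s \<Longrightarrow> homogeneous s (Poly_Mapping.single w (Poly_Mapping.single a c))"
  by (auto simp: homogeneous_def lookup_single when_def)

lemma homogeneous_imp_below: "homogeneous s p \<Longrightarrow> s < t \<Longrightarrow> below t p"
  by (auto simp: homogeneous_def below_def)

lemma below_mono: "below s p \<Longrightarrow> s \<le> t \<Longrightarrow> below t p"
  by (fastforce simp: below_def)

lemma leading_imp_below:
  assumes "leading s p q" "s < t"
  shows "below t p"
proof -
  have "below t ((p - q) + q)"
    using assms homogeneous_imp_below below_mono unfolding leading_def
    by (intro below_add) (auto intro: less_imp_le)
  then show ?thesis by simp
qed

lemma leading_0: "leading s 0 0"
  by (simp add: leading_def)

lemma leading_add: "leading s p q \<Longrightarrow> leading s p' q' \<Longrightarrow> leading s (p + p') (q + q')"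
  unfolding leading_def by (simp add: homogeneous_add below_add add_diff_add)

lemma leading_diff:
  assumes "leading s p q" "leading s p' q'"
  shows "leading s (p - p') (q - q')"
proof -
  have "p - p' - (q - q') = (p - q) - (p' - q')" by simp
  then show ?thesis
    using assms unfolding leading_def by (simp only: homogeneous_diff below_diff)
qed

lemma leading_sum: "(\<And>i. i \<in> I \<Longrightarrow> leading s (f i) (g i)) \<Longrightarrow> leading s (sum f I) (sum g I)"
  by (induction I rule: infinite_finite_induct) (simp_all add: leading_0 leading_add)

lemma leading_unique:
  assumes "leading s p q" "leading s p q'"
  shows "q = q'"
proof -
  have "homogeneous s (q - q')"
    using assms by (simp add: leading_def homogeneous_diff)
  moreover have "below s ((p - q') - (p - q))"
    using assms unfolding leading_def by (blast intro: below_diff)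
  then have "below s (q - q')" by simp
  ultimately have "Poly_Mapping.lookup (Poly_Mapping.lookup (q - q') w) a = 0" for w a
    unfolding homogeneous_def below_def by (metis less_irrefl)
  then have "q - q' = 0"
    by (intro poly_mapping_eqI) simp
  then show ?thesis by simp
qed

lemma additive_homogeneous:
  assumes add: "\<And>p q. F (p + q) = F p + F q"
    and mono: "\<And>w a c. homogeneous (wt w a + \<gamma>) (F (Poly_Mapping.single w (Poly_Mapping.single a c)))"
    and p: "homogeneous s p"
  shows "homogeneous (s + \<gamma>) (F p)"
proof (induction p rule: nested_induct)
  case zero
  have "F 0 = 0" using add[of 0 0] by simp
  then show ?case by simp
next
  case (single w a)
  then have "wt w a = s" using p by (simp add: homogeneous_def)
  with mono show ?case by metis
qed (simp add: add homogeneous_add)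

lemma additive_below:
  assumes add: "\<And>p q. F (p + q) = F p + F q"
    and mono: "\<And>w a c. homogeneous (wt w a + \<gamma>) (F (Poly_Mapping.single w (Poly_Mapping.single a c)))"
    and p: "below s p"
  shows "below (s + \<gamma>) (F p)"
proof (induction p rule: nested_induct)
  case zero
  have "F 0 = 0" using add[of 0 0] by simp
  then show ?case by simp
next
  case (single w a)
  then have "wt w a + \<gamma> < s + \<gamma>" using p by (simp add: below_def)
  with mono show ?case by (blast intro: homogeneous_imp_below)
qed (simp add: add below_add)

lemma additive_leading:
  assumes add: "\<And>p q. F (p + q) = F p + F q"
    and mono: "\<And>w a c. homogeneous (wt w a + \<gamma>) (F (Poly_Mapping.single w (Poly_Mapping.single a c)))"
    and p: "leading s p q"
  shows "leading (s + \<gamma>) (F p) (F q)"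
proof -
  have "F (p - q) = F p - F q"
    using add[of "p - q" q] by simp
  then show ?thesis
    using p additive_homogeneous[OF add mono] additive_below[OF add mono]
    unfolding leading_def by metis
qed

lemma monomial_mult:
  "Poly_Mapping.single 0 (Poly_Mapping.single a c) * Poly_Mapping.single w (Poly_Mapping.single b d) =
    Poly_Mapping.single w (Poly_Mapping.single (a + b) (c * d :: 'k))" for w :: "'n fmonoid"
  by (simp add: mult_single)

lemma leading_word_var: "leading s p q \<Longrightarrow> leading (s + \<beta>) (word_var i * p) (word_var i * q)"
proof (erule additive_leading[rotated 2])
  show "homogeneous (wt w a + \<beta>) (word_var i * Poly_Mapping.single w (Poly_Mapping.single a c))" for w a c
    by (auto intro!: homogeneous_monomial simp: word_var_def mult_single wt_def plus_fmonoid_def algebra_simps)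
qed (simp add: distrib_left)

lemma homogeneous_const_mult:
  assumes "homogeneous s p"
  shows "homogeneous (s + \<alpha> * real (exp_degree a))
    (Poly_Mapping.single 0 (Poly_Mapping.single a c) * p)"
proof (rule additive_homogeneous[OF _ _ assms])
  show "homogeneous (wt w b + \<alpha> * real (exp_degree a))
      (Poly_Mapping.single 0 (Poly_Mapping.single a c) * Poly_Mapping.single w (Poly_Mapping.single b d))" for w b d
    unfolding monomial_mult
    by (rule homogeneous_monomial) (simp add: wt_def exp_degree_add algebra_simps)
qed (simp add: distrib_left)

lemma leading_const_mult:
  assumes "leading s p q"
  shows "leading (s + \<alpha> * real (exp_degree a))
    (Poly_Mapping.single 0 (Poly_Mapping.single a c) * p)
    (Poly_Mapping.single 0 (Poly_Mapping.single a c) * q)"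
  by (rule additive_leading[OF _ _ assms])
    (auto simp: distrib_left intro: homogeneous_const_mult homogeneous_monomial)

lemma homogeneous_delta_monomial:
  "homogeneous (wt w a + \<beta>) (delta j (Poly_Mapping.single w (Poly_Mapping.single a c)))"
proof -
  have "homogeneous (\<beta> * real (length ws) + \<beta>) (insertions j ws)" for ws
  proof (induction ws)
    case (Cons i ws)
    have "homogeneous (\<beta> * real (length ws) + \<beta> + \<beta>) (word_var i * insertions j ws)"
      using leading_word_var[of "\<beta> * real (length ws) + \<beta>" "insertions j ws" "insertions j ws" i] Cons
      by (simp add: leading_def)
    moreover have "homogeneous (\<beta> * real (length ws) + \<beta> + \<beta>)
        (Poly_Mapping.single (FM (i # j # ws)) (Poly_Mapping.single 0 1))"
      by (rule homogeneous_monomial) (simp add: wt_def algebra_simps)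
    ultimately show ?case
      by (simp add: homogeneous_add algebra_simps)
  qed simp
  from homogeneous_const_mult[OF this, of "letters w" a c] show ?thesis
    by (simp add: delta_single wt_def algebra_simps)
qed

lemma leading_delta: "leading s p q \<Longrightarrow> leading (s + \<beta>) (delta j p) (delta j q)"
  by (erule additive_leading[rotated 2]) (simp_all add: delta_add homogeneous_delta_monomial)

text \<open>The correction \<open>delta j (nf v)\<close> has weight at most
  \<open>s + \<beta>\<close>, hence lies below \<open>s + \<alpha>\<close>.\<close>

lemma leading_nf_l_mult:
  assumes "leading s (nf v) q"
  shows "leading (s + \<alpha>) (nf (U_l j * v)) (Poly_Mapping.single 0 (L_var j) * q)"
proof -
  have "below (s + \<alpha>) (delta j (nf v))"
    using leading_imp_below[OF leading_delta[OF assms]] \<beta>_less_\<alpha> by simp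
  then have "leading (s + \<alpha>) (delta j (nf v)) 0"
    by (simp add: leading_def)
  moreover have "leading (s + \<alpha>) (Poly_Mapping.single 0 (L_var j) * nf v)
      (Poly_Mapping.single 0 (L_var j) * q)"
    using leading_const_mult[OF assms, of "Poly_Mapping.single j 1" 1] by (simp add: L_var_def)
  ultimately show ?thesis
    using leading_diff by (fastforce simp: nf_l_mult)
qed

lemma leading_nf_monomial_mult:
  assumes "leading t (nf v) y"
  shows "leading (wt w a + t) (nf (of_nf (Poly_Mapping.single w (Poly_Mapping.single a c)) * v))
    (Poly_Mapping.single w (Poly_Mapping.single a c) * y)"
proof -
  have l: "leading (\<alpha> * real (exp_degree a) + t) (nf (L_to_U (Poly_Mapping.single a c) * v))
      (Poly_Mapping.single 0 (Poly_Mapping.single a c) * y)"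
  proof (induction a rule: exponent_induct)
    case zero
    have "Poly_Mapping.single 0 c = pm_scale c (1 :: ('n, 'k) L)"
      by (simp add: pm_scale_conv_mult)
    then have "L_to_U (Poly_Mapping.single 0 c :: ('n, 'k) L) = U_scale c 1"
      by (simp only: alg_homD[OF L_to_U_hom])
    then show ?case
      using leading_const_mult[OF assms, of 0 c]
      by (simp add: U_scale_mult_left nf_scale)
  next
    case (add i b)
    have "(Poly_Mapping.single (Poly_Mapping.single i 1 + b) c :: ('n, 'k) L) =
        L_var i * Poly_Mapping.single b c"
      by (simp add: L_var_def mult_single)
    moreover have "Poly_Mapping.single 0 (L_var i * Poly_Mapping.single b c) * y =
        Poly_Mapping.single 0 (L_var i) * (Poly_Mapping.single 0 (Poly_Mapping.single b c) * y)"
      by (simp add: mult_single flip: mult.assoc)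
    ultimately show ?case
      using leading_nf_l_mult[OF add, of i]
      by (simp add: alg_homD[OF L_to_U_hom] mult.assoc exp_degree_add algebra_simps)
  qed
  have "leading (\<beta> * real (length ws) + (\<alpha> * real (exp_degree a) + t))
      (nf ((\<Prod>i\<leftarrow>ws. U_r i) * (L_to_U (Poly_Mapping.single a c) * v)))
      (Poly_Mapping.single (FM ws) (Poly_Mapping.single a c) * y)" for ws
  proof (induction ws)
    case Nil
    from l show ?case by (simp flip: zero_fmonoid_def)
  next
    case (Cons i ws)
    from leading_word_var[OF this, of i] show ?case
      by (simp add: nf_r_mult mult.assoc word_single_Cons algebra_simps)
  qed
  from this[of "letters w"] show ?thesis
    by (simp add: wt_def of_nf_single mult.assoc add_ac)
qed

text \<open>The product of leading forms is taken in the free algebra over \<open>L_n\<close>, which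
  plays the role of the associated graded algebra. The monomials of \<open>x\<close> contribute the
  product, those of \<open>nf u - x\<close> only smaller weights.\<close>

lemma leading_nf_mult:
  assumes "leading s (nf u) x" "leading t (nf v) y"
  shows "leading (s + t) (nf (u * v)) (x * y)"
proof -
  let ?Q = "\<lambda>p. nf (of_nf p * v)"
  have Q_add: "?Q (p + q) = ?Q p + ?Q q" for p q
    by (simp add: of_nf_add distrib_right nf_add)
  have "leading (s + t) (?Q x) (x * y)"
  proof (induction x rule: nested_induct)
    case (single w a)
    then have "wt w a = s"
      using assms(1) by (simp add: leading_def homogeneous_def)
    then show ?case
      using leading_nf_monomial_mult[OF assms(2)] by metis
  qed (simp_all add: leading_0 Q_add distrib_right leading_add)
  moreover define d where "d = nf u - x"
  have "below (s + t) (?Q d)"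
  proof (induction d rule: nested_induct)
    case (single w a)
    then have "wt w a + t < s + t"
      using assms(1) by (simp add: leading_def below_def d_def)
    then show ?case
      using leading_nf_monomial_mult[OF assms(2)] leading_imp_below by metis
  qed (simp_all add: Q_add below_add)
  then have "leading (s + t) (?Q d) 0"
    by (simp add: leading_def)
  ultimately have "leading (s + t) (?Q x + ?Q d) (x * y + 0)"
    by (rule leading_add)
  then show ?thesis
    by (simp add: d_def flip: Q_add)
qed

section \<open>Weight components and the relation between leading forms\<close>

definition component :: "real \<Rightarrow> ('n fmonoid \<Rightarrow>\<^sub>0 ('n, 'k) L) \<Rightarrow> 'n fmonoid \<Rightarrow>\<^sub>0 ('n, 'k) L"
  where "component s p = Poly_Mapping.mapp (\<lambda>w. Poly_Mapping.mapp (\<lambda>a c. c when wt w a = s)) p"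

lemma lookup_component:
  "Poly_Mapping.lookup (Poly_Mapping.lookup (component s p) w) a =
    (Poly_Mapping.lookup (Poly_Mapping.lookup p w) a when wt w a = s)"
  by (auto simp: component_def lookup_mapp when_def in_keys_iff)

lemma leading_component:
  assumes "\<And>w a. Poly_Mapping.lookup (Poly_Mapping.lookup p w) a \<noteq> 0 \<Longrightarrow> wt w a \<le> s"
  shows "leading s p (component s p)"
  using assms unfolding leading_def homogeneous_def below_def
  by (fastforce simp: lookup_component lookup_minus when_def split: if_splits)

text \<open>The commutator of \<open>r i\<close> with l_j has normal form exactly
  \<open>delta j (nf (r i))\<close>, so the terms of weight \<open>\<alpha> + \<beta>\<close> cancel
  and the relation can be read off at weight \<open>\<beta> + \<beta>\<close>.\<close>

lemma leading_forms_relation: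
  assumes rel: "\<And>i j. r i * (U_l j + e j) = (U_l j + e j) * r i + r i * r j"
    and r: "\<And>i. leading \<beta> (nf (r i)) (R i)" and e: "\<And>j. leading \<beta> (nf (e j)) (E j)"
  shows "delta j (R i) + R i * E j - E j * R i = R i * R j"
proof -
  have "nf (r i * U_l j) - nf (U_l j * r i) + nf (r i * e j) - nf (e j * r i) = nf (r i * r j)"
    using arg_cong[OF rel[of i j], of nf]
    by (simp add: distrib_left distrib_right nf_add algebra_simps)
  then have "delta j (nf (r i)) + nf (r i * e j) - nf (e j * r i) = nf (r i * r j)"
    by (simp add: nf_mult_l nf_l_mult)
  moreover have "leading (\<beta> + \<beta>) (delta j (nf (r i)) + nf (r i * e j) - nf (e j * r i))
      (delta j (R i) + R i * E j - E j * R i)"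
    by (intro leading_diff leading_add leading_delta leading_nf_mult r e)
  moreover have "leading (\<beta> + \<beta>) (nf (r i * r j)) (R i * R j)"
    by (intro leading_nf_mult r)
  ultimately show ?thesis
    using leading_unique by metis
qed

end

section \<open>Restricting automorphisms from \<open>U\<^sub>n\<close> to \<open>L\<^sub>n\<close>\<close>

definition restrict_aut :: "(('n::finite, 'k::field) U \<Rightarrow> ('n, 'k) U) \<Rightarrow> ('n, 'k) L \<Rightarrow> ('n, 'k) L"
  where "restrict_aut \<psi> f = U_to_L (\<psi> (L_to_U f))"

text \<open>r_i^2 is the commutator of r_i and l_i, so its image in the commutative domain
  \<open>L_n\<close> vanishes.\<close>

lemma U_to_L_end_r:
  fixes \<psi> :: "('n::finite, 'k::field) U \<Rightarrow> ('n, 'k) U"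
  assumes "alg_hom U_scale U_scale \<psi>"
  shows "U_to_L (\<psi> (U_r i)) = 0"
proof -
  note hom = alg_homD[OF assms] alg_homD[OF U_to_L_hom]
  have "U_r i * U_r i = U_r i * U_l i - U_l i * (U_r i :: ('n, 'k) U)"
    by (simp add: U_r_l)
  from arg_cong[OF this, of "\<lambda>u. U_to_L (\<psi> u)"]
  have "U_to_L (\<psi> (U_r i)) * U_to_L (\<psi> (U_r i)) = 0"
    by (simp add: hom mult.commute)
  then show ?thesis
    using L_no_zero_divisors by blast
qed

text \<open>Both sides are homomorphisms in \<open>u\<close> that agree on generators, so
  \<open>restrict_aut\<close> is the induced map on the quotient and does not depend on the
  representative \<open>L_to_U f\<close>.\<close>

lemma restrict_aut_U_to_L:
  assumes \<psi>: "alg_hom U_scale U_scale \<psi>"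
  shows "restrict_aut \<psi> (U_to_L u) = U_to_L (\<psi> u)"
proof -
  have "(U_to_L \<circ> \<psi> \<circ> L_to_U \<circ> U_to_L) u = (U_to_L \<circ> \<psi>) u"
  proof (rule U_alg_hom_eqI)
    show "alg_hom U_scale pm_scale (U_to_L \<circ> \<psi> \<circ> L_to_U \<circ> U_to_L)"
      "alg_hom U_scale pm_scale (U_to_L \<circ> \<psi>)"
      by (rule alg_hom_comp alg_hom_comp[OF U_to_L_hom] alg_hom_comp[OF L_to_U_hom]
          alg_hom_comp[OF \<psi>] U_to_L_hom)+
  qed (simp_all add: U_to_L_end_r[OF \<psi>] alg_homD[OF \<psi>] alg_homD[OF U_to_L_hom]
      alg_homD[OF L_to_U_hom])
  then show ?thesis
    by (simp add: restrict_aut_def)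
qed

lemma restrict_aut_comp:
  assumes "alg_hom U_scale U_scale \<psi>"
  shows "restrict_aut (\<psi> \<circ> \<chi>) = restrict_aut \<psi> \<circ> restrict_aut \<chi>"
  using restrict_aut_U_to_L[OF assms] by (auto simp: restrict_aut_def)

lemma restrict_aut_in_auts:
  fixes \<psi> :: "('n::finite, 'k::field) U \<Rightarrow> ('n, 'k) U"
  assumes "\<psi> \<in> algebra_auts U_scale"
  shows "restrict_aut \<psi> \<in> algebra_auts pm_scale"
proof -
  let ?\<chi> = "inv_into UNIV \<psi>"
  have \<psi>: "bij \<psi>" "alg_hom U_scale U_scale \<psi>" and \<chi>: "alg_hom U_scale U_scale ?\<chi>"
    using assms inv_alg_hom[OF assms] by (simp_all add: mem_algebra_auts)
  have "restrict_aut \<psi> \<circ> restrict_aut ?\<chi> = restrict_aut (\<psi> \<circ> ?\<chi>)"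
    "restrict_aut ?\<chi> \<circ> restrict_aut \<psi> = restrict_aut (?\<chi> \<circ> \<psi>)"
    by (simp_all only: restrict_aut_comp[OF \<psi>(2)] restrict_aut_comp[OF \<chi>])
  moreover have "\<psi> \<circ> ?\<chi> = id" "?\<chi> \<circ> \<psi> = id"
    using \<psi>(1) by (simp_all add: bij_def surj_iff inj_iff)
  moreover have "restrict_aut id = (id :: ('n, 'k) L \<Rightarrow> _)"
    by (auto simp: restrict_aut_def)
  ultimately have "bij (restrict_aut \<psi>)"
    by (simp add: o_bij)
  moreover have "restrict_aut \<psi> = U_to_L \<circ> (\<psi> \<circ> L_to_U)"
    by (auto simp: restrict_aut_def)
  ultimately show ?thesis
    by (simp add: mem_algebra_auts alg_hom_comp[OF alg_hom_comp[OF L_to_U_hom \<psi>(2)] U_to_L_hom])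
qed

section \<open>Automorphisms of \<open>U\<^sub>n\<close> that are trivial on \<open>L\<^sub>n\<close>\<close>

text \<open>
  With \<open>V\<close> and \<open>B\<close> the matrices of the linear parts of \<open>\<psi> r\<^sub>i\<close> and \<open>\<psi> l\<^sub>j - l\<^sub>j\<close>, the quadratic part of
  the relations says \<open>v\<^sub>i \<otimes> c\<^sub>j = b\<^sub>j \<otimes> v\<^sub>i\<close>. If \<open>b\<^sub>j \<noteq> 0\<close>, all \<open>v\<^sub>i\<close> would be proportional to \<open>c\<^sub>j\<close>.
\<close>

lemma linear_parts_trivial:
  fixes V B :: "'n::finite \<Rightarrow> 'n \<Rightarrow> 'c::comm_ring_1" and p0 p1 :: 'n
  assumes nzd: "\<And>x y :: 'c. x * y = 0 \<Longrightarrow> x = 0 \<or> y = 0"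
    and "p0 \<noteq> p1"
    and eq: "\<And>i j m p. (V i m when p = j) + V i m * B j p - B j m * V i p = V i m * V j p"
    and span: "\<And>p. \<exists>g. \<forall>m. (\<Sum>i\<in>UNIV. V i m * g i) = (1 when m = p)"
  shows "B j m = 0" and "V j p = (1 when p = j)"
proof -
  define c where "c p = (1 when p = j) + B j p - V j p" for p
  have c: "V i m * c p = B j m * V i p" for i m p
    using eq[of i m p j] by (simp add: c_def when_def algebra_simps split: if_splits)
  have B: "B j m = 0" for m
  proof (rule ccontr)
    assume b: "B j m \<noteq> 0"
    \<comment> \<open>Combining the relations \<open>c\<close> with the coefficients from
      \<open>span\<close> makes \<open>B j m\<close> times each unit vector a multiple of
      \<open>c\<close>; two different unit vectors then contradict each other in a domain.\<close>
    have "\<exists>x. \<forall>p. x * c p = (B j m when p = q)" for q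
    proof -
      obtain g where g: "\<And>m. (\<Sum>i\<in>UNIV. V i m * g i) = (1 when m = q)"
        using span[of q] by blast
      have "(\<Sum>i\<in>UNIV. V i m * g i) * c p = (B j m when p = q)" for p
      proof -
        have "(\<Sum>i\<in>UNIV. V i m * g i) * c p = (\<Sum>i\<in>UNIV. B j m * V i p * g i)"
          by (simp add: sum_distrib_left sum_distrib_right mult_ac flip: c)
        also have "\<dots> = B j m * (1 when p = q)"
          by (simp add: mult.assoc g flip: sum_distrib_left)
        finally show ?thesis by (simp add: mult_when)
      qed
      then show ?thesis by blast
    qed
    then obtain x y where "\<And>p. x * c p = (B j m when p = p0)" "\<And>p. y * c p = (B j m when p = p1)"
      by metis
    from this[of p0] this[of p1] \<open>p0 \<noteq> p1\<close> b show False
      by (auto simp: when_def dest!: nzd)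
  qed
  then show "B j m = 0" .
  obtain g where g: "\<And>m. (\<Sum>i\<in>UNIV. V i m * g i) = (1 when m = p)"
    using span[of p] by blast
  have "c p = (\<Sum>i\<in>UNIV. V i p * g i) * c p"
    by (simp add: g)
  also have "\<dots> = (\<Sum>i\<in>UNIV. V i p * c p * g i)"
    by (simp add: sum_distrib_left sum_distrib_right mult_ac)
  also have "\<dots> = 0"
    by (simp add: c B)
  finally show "V j p = (1 when p = j)"
    by (simp add: c_def B)
qed

lemma lookup_delta_1: "Poly_Mapping.lookup (delta j q) (FM [p]) = 0"
  by (induction q rule: word_induct)
    (simp_all add: delta_add lookup_add delta_word_var_mult lookup_word_var_mult when_def
      flip: zero_fmonoid_def)

lemma lookup_delta_2:
  "Poly_Mapping.lookup (delta j q) (FM [m, p]) = (Poly_Mapping.lookup q (FM [m]) when p = j)"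
proof (induction q rule: word_induct)
  case (const c)
  then show ?case
    by (simp add: lookup_single) (simp add: zero_fmonoid_def)
next
  case (var i q)
  then show ?case
    by (auto simp: delta_word_var_mult lookup_add lookup_word_var_mult when_def lookup_delta_1)
qed (simp add: delta_add lookup_add when_add_distrib)

lemma lookup_word_var: "Poly_Mapping.lookup (word_var i) w = (1 when w = FM [i])"
  by (auto simp: word_var_def lookup_single when_def)

lemma lookup_mult_2:
  fixes p q :: "'n fmonoid \<Rightarrow>\<^sub>0 'c::comm_ring_1"
  assumes "deg_le 1 p" "deg_le 1 q"
  shows "Poly_Mapping.lookup (p * q) (FM [m, n]) =
    Poly_Mapping.lookup p (FM [m]) * Poly_Mapping.lookup q (FM [n])"
  using lookup_mult_top[of "[m]" p "[n]" q] assms by simp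

section \<open>A fixed automorphism inducing the identity on \<open>L_n\<close>, and its linear
  part\<close>

context
  fixes \<psi> :: "('n::finite, 'k::field_char_0) U \<Rightarrow> ('n, 'k) U" and p0 p1 :: 'n
  assumes aut: "\<psi> \<in> algebra_auts U_scale"
    and trivial: "restrict_aut \<psi> = id"
    and "p0 \<noteq> p1"
begin

lemmas \<psi>_hom = alg_homD[OF conjunct2[OF iffD1[OF mem_algebra_auts aut]]]

lemma U_to_L_aut: "U_to_L (\<psi> u) = U_to_L u"
  using restrict_aut_U_to_L[of \<psi> u] aut trivial by (simp add: mem_algebra_auts)

definition dl :: "'n \<Rightarrow> ('n, 'k) U"
  where "dl j = \<psi> (U_l j) - U_l j"

lemma aut_relation:
  "\<psi> (U_r i) * (U_l j + dl j) = (U_l j + dl j) * \<psi> (U_r i) + \<psi> (U_r i) * \<psi> (U_r j)"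
  using arg_cong[OF U_r_l[of i j], of \<psi>] by (simp add: dl_def \<psi>_hom)

lemma lookup_nf_aut_0: "Poly_Mapping.lookup (nf (\<psi> (U_r i))) 0 = 0"
  "Poly_Mapping.lookup (nf (dl j)) 0 = 0"
  by (simp_all add: U_to_L_aut dl_def alg_homD[OF U_to_L_hom] flip: U_to_L_conv_nf)

lemma lookup_nf_aut_1:
  "Poly_Mapping.lookup (nf (dl j)) (FM [m]) = 0"
  "Poly_Mapping.lookup (nf (\<psi> (U_r j))) (FM [m]) = (1 when m = j)"
proof -
  \<comment> \<open>The weight is minus the word length, so leading forms are parts of lowest order
    in the r_i, and \<open>component (-1)\<close> is the linear part.\<close>
  interpret weights 0 "-1" "TYPE('n \<times> 'k)"
    by unfold_locales simp
  have wt: "wt w a = - real (length (letters w))" for w a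
    by (simp add: wt_def)
  define R where "R i = component (-1) (nf (\<psi> (U_r i)))" for i
  define E where "E j = component (-1) (nf (dl j))" for j
  have *: "leading (-1) p (component (-1) p)" if "Poly_Mapping.lookup p 0 = 0" for p
  proof (rule leading_component)
    show "wt w a \<le> -1" if "Poly_Mapping.lookup (Poly_Mapping.lookup p w) a \<noteq> 0" for w a
    proof -
      have "w \<noteq> 0"
        using that \<open>Poly_Mapping.lookup p 0 = 0\<close> by auto
      then have "length (letters w) \<ge> 1"
        by (cases w) (auto simp: zero_fmonoid_def Suc_le_eq)
      then show ?thesis by (simp add: wt)
    qed
  qed
  have R: "leading (-1) (nf (\<psi> (U_r i))) (R i)" and E: "leading (-1) (nf (dl j)) (E j)" for i j
    by (simp_all add: R_def E_def * lookup_nf_aut_0)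
  have lookup: "Poly_Mapping.lookup (component (-1) p) (FM [m]) = Poly_Mapping.lookup p (FM [m])" for p m
    by (rule poly_mapping_eqI) (simp add: lookup_component wt)
  have deg: "deg_le 1 (component (-1) p)" for p
    unfolding deg_le_def
  proof (intro allI impI)
    fix w assume "Poly_Mapping.lookup (component (-1) p) w \<noteq> 0"
    then obtain a where "Poly_Mapping.lookup (Poly_Mapping.lookup (component (-1) p) w) a \<noteq> 0"
      by (metis lookup_zero poly_mapping_eqI)
    then show "length (letters w) \<le> 1"
      by (simp add: lookup_component wt)
  qed
  have lookup_mult: "Poly_Mapping.lookup (component (-1) p * component (-1) q) (FM [m, n]) =
      Poly_Mapping.lookup p (FM [m]) * Poly_Mapping.lookup q (FM [n])" for p q m n
    by (simp only: lookup_mult_2[OF deg deg] lookup)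
  have rel: "delta j (R i) + R i * E j - E j * R i = R i * R j" for i j
    using leading_forms_relation[OF aut_relation R E] .
  let ?V = "\<lambda>i m. Poly_Mapping.lookup (nf (\<psi> (U_r i))) (FM [m])"
  let ?B = "\<lambda>j m. Poly_Mapping.lookup (nf (dl j)) (FM [m])"
  have eq: "(?V i m when p = j) + ?V i m * ?B j p - ?B j m * ?V i p = ?V i m * ?V j p" for i j m p
    using arg_cong[OF rel[of j i], of "\<lambda>q. Poly_Mapping.lookup q (FM [m, p])"]
    by (simp add: lookup_add lookup_minus lookup_delta_2 R_def E_def lookup_mult lookup)
  \<comment> \<open>Surjectivity of \<open>\<psi>\<close> gives this: a preimage of r_p lies in the
    kernel of \<open>U_to_L\<close>, hence in the right ideal of the r_i. Linear parts of its image
    are then compared.\<close>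
  have span: "\<exists>g. \<forall>m. (\<Sum>i\<in>UNIV. ?V i m * g i) = (1 when m = p)" for p
  proof -
    obtain y where y: "\<psi> y = U_r p"
      using aut by (metis mem_algebra_auts bij_pointE)
    then have "U_to_L y = 0"
      using U_to_L_aut[of y] by simp
    then obtain x where "y = (\<Sum>i\<in>UNIV. U_r i * x i)"
      by (rule U_to_L_eq_0)
    with y have p: "U_r p = (\<Sum>i\<in>UNIV. \<psi> (U_r i) * \<psi> (x i))"
      by (simp add: \<psi>_hom)
    \<comment> \<open>The part of order 0 in the r's; its coefficient at the empty word is the
      witness \<open>g i\<close>.\<close>
    define X where "X i = component 0 (nf (\<psi> (x i)))" for i
    have "leading (-1 + 0) (nf (U_r p)) (\<Sum>i\<in>UNIV. R i * X i)"
      unfolding p nf_sum X_def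
      by (intro leading_sum leading_nf_mult R leading_component) (simp add: wt)
    moreover have "homogeneous (-1) (Poly_Mapping.single (FM [p]) (Poly_Mapping.single 0 1))"
      by (rule homogeneous_monomial) (simp add: wt)
    then have "leading (-1 + 0) (nf (U_r p)) (nf (U_r p))"
      by (simp add: leading_def nf_r word_var_def)
    ultimately have sum: "(\<Sum>i\<in>UNIV. R i * X i) = nf (U_r p)"
      by (rule leading_unique)
    have lookup_R_X: "Poly_Mapping.lookup (R i * X i) (FM [m]) = ?V i m * Poly_Mapping.lookup (X i) 0" for i m
    proof -
      have "deg_le 0 (X i)"
        unfolding deg_le_def
      proof (intro allI impI)
        fix w assume "Poly_Mapping.lookup (X i) w \<noteq> 0"
        then obtain a where "Poly_Mapping.lookup (Poly_Mapping.lookup (X i) w) a \<noteq> 0"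
          by (metis lookup_zero poly_mapping_eqI)
        then show "length (letters w) \<le> 0"
          by (simp add: X_def lookup_component wt)
      qed
      then show ?thesis
        using lookup_mult_top[of "[m]" "R i" "[]" "X i"] deg[of "nf (\<psi> (U_r i))"]
        by (simp add: R_def lookup flip: zero_fmonoid_def)
    qed
    have "(\<Sum>i\<in>UNIV. ?V i m * Poly_Mapping.lookup (X i) 0) =
        Poly_Mapping.lookup (\<Sum>i\<in>UNIV. R i * X i) (FM [m])" for m
      by (simp add: lookup_sum lookup_R_X)
    then have "(\<Sum>i\<in>UNIV. ?V i m * Poly_Mapping.lookup (X i) 0) = (1 when m = p)" for m
      by (simp add: sum nf_r lookup_word_var)
    then show ?thesis
      by (intro exI[of _ "\<lambda>i. Poly_Mapping.lookup (X i) 0"]) simp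
  qed
  note nzd = L_no_zero_divisors
  show "?B j m = 0" "?V j m = (1 when m = j)"
    using linear_parts_trivial[where V = ?V and B = ?B, OF nzd \<open>p0 \<noteq> p1\<close> eq span] by blast+
qed

lemma short_words:
  assumes "length (letters w) \<le> 1"
  shows "Poly_Mapping.lookup (nf (dl j)) w = 0"
    "Poly_Mapping.lookup (nf (\<psi> (U_r j))) w = Poly_Mapping.lookup (word_var j) w"
proof -
  have "w = 0 \<or> (\<exists>m. w = FM [m])"
    using assms by (cases w) (auto simp: zero_fmonoid_def le_Suc_eq length_Suc_conv)
  then show "Poly_Mapping.lookup (nf (dl j)) w = 0"
    "Poly_Mapping.lookup (nf (\<psi> (U_r j))) w = Poly_Mapping.lookup (word_var j) w"
    by (auto simp: lookup_nf_aut_0 lookup_nf_aut_1 lookup_word_var when_def)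
      (simp_all add: zero_fmonoid_def split: if_splits)
qed

section \<open>Terms of higher order in the deviation from the identity\<close>

definition dr :: "'n \<Rightarrow> 'n fmonoid \<Rightarrow>\<^sub>0 ('n, 'k) L"
  where "dr i = nf (\<psi> (U_r i)) - word_var i"

definition support :: "('n fmonoid \<times> ('n \<Rightarrow>\<^sub>0 nat)) set"
  where "support = {(w, a). (\<exists>i. Poly_Mapping.lookup (Poly_Mapping.lookup (dr i) w) a \<noteq> 0) \<or>
    (\<exists>j. Poly_Mapping.lookup (Poly_Mapping.lookup (nf (dl j)) w) a \<noteq> 0)}"

lemma finite_support: "finite support"
proof -
  have "support \<subseteq>
      (\<Union>i. Sigma (Poly_Mapping.keys (dr i)) (\<lambda>w. Poly_Mapping.keys (Poly_Mapping.lookup (dr i) w))) \<union>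
      (\<Union>j. Sigma (Poly_Mapping.keys (nf (dl j))) (\<lambda>w. Poly_Mapping.keys (Poly_Mapping.lookup (nf (dl j)) w)))"
    (is "_ \<subseteq> ?S")
  proof
    fix x assume "x \<in> support"
    moreover have "Poly_Mapping.lookup p w \<noteq> 0" if "Poly_Mapping.lookup (Poly_Mapping.lookup p w) a \<noteq> 0"
      for p :: "'n fmonoid \<Rightarrow>\<^sub>0 ('n, 'k) L" and w a
      using that by auto
    ultimately show "x \<in> ?S"
      by (cases x) (simp add: support_def in_keys_iff, blast)
  qed
  then show ?thesis
    by (rule finite_subset) auto
qed

lemma support_length: "(w, a) \<in> support \<Longrightarrow> length (letters w) \<ge> 2"
  by (rule ccontr) (auto simp: support_def dr_def lookup_minus short_words)

text \<open>
  The weights put \<open>r\<^sub>i\<close> and the monomials of the support of maximal slope \<open>c\<close> on one line, so that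
  leading forms of all \<open>\<psi> r\<^sub>i\<close> and \<open>\<psi> l\<^sub>j - l\<^sub>j\<close> enter the relation with the same weight.
\<close>

lemma support_empty: "support = {}"
proof (rule ccontr)
  assume "support \<noteq> {}"
  \<comment> \<open>For words of length at least 2 the denominator is positive, and slope at most
    \<open>c\<close> says exactly that the weight for \<open>\<alpha> = 1\<close>,
    \<open>\<beta> = 1 - c\<close> is at most \<open>1 - c\<close>, the weight of r_i. Equality
    holds at a monomial of maximal slope.\<close>
  define slope where "slope = (\<lambda>(w, a :: 'n \<Rightarrow>\<^sub>0 nat).
    (real (exp_degree a) + real (length (letters (w :: 'n fmonoid))) - 1) / (real (length (letters w)) - 1))"
  define c where "c = Max (slope ` support)"
  have "c \<in> slope ` support"
    unfolding c_def using finite_support \<open>support \<noteq> {}\<close> by (intro Max_in) auto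
  then obtain w0 a0 where w0: "(w0, a0) \<in> support" "slope (w0, a0) = c"
    by auto
  have slope_le: "slope x \<le> c" if "x \<in> support" for x
    unfolding c_def using finite_support that by (intro Max_ge) auto
  have "c > 0"
    using w0 support_length[OF w0(1)] by (auto simp: slope_def)
  interpret weights 1 "1 - c" "TYPE('n \<times> 'k)"
    using \<open>c > 0\<close> by unfold_locales simp
  have wt_le: "wt w a \<le> 1 - c" if "(w, a) \<in> support" for w a
    using slope_le[OF that] support_length[OF that]
    by (simp add: slope_def wt_def divide_le_eq algebra_simps)
  have wt0: "wt w0 a0 = 1 - c"
    using w0(2) support_length[OF w0(1)]
    by (simp add: slope_def wt_def divide_eq_eq algebra_simps)
  have lookup_word_var_wt: "wt w a = 1 - c"
    if "Poly_Mapping.lookup (Poly_Mapping.lookup (word_var i :: _ \<Rightarrow>\<^sub>0 ('n, 'k) L) w) a \<noteq> 0" for i w a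
    using that by (auto simp: lookup_word_var when_def lookup_one wt_def split: if_splits)
  have nf_\<psi>_r: "nf (\<psi> (U_r i)) = word_var i + dr i" for i
    by (simp add: dr_def)
  define R where "R i = component (1 - c) (nf (\<psi> (U_r i)))" for i
  define E where "E j = component (1 - c) (nf (dl j))" for j
  have R: "leading (1 - c) (nf (\<psi> (U_r i))) (R i)" for i
    unfolding R_def
  proof (rule leading_component)
    fix w a assume "Poly_Mapping.lookup (Poly_Mapping.lookup (nf (\<psi> (U_r i))) w) a \<noteq> 0"
    then have "Poly_Mapping.lookup (Poly_Mapping.lookup (word_var i :: _ \<Rightarrow>\<^sub>0 ('n, 'k) L) w) a \<noteq> 0 \<or>
        Poly_Mapping.lookup (Poly_Mapping.lookup (dr i) w) a \<noteq> 0"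
      by (auto simp: nf_\<psi>_r lookup_add)
    then show "wt w a \<le> 1 - c"
      using lookup_word_var_wt wt_le by (fastforce simp: support_def)
  qed
  have E: "leading (1 - c) (nf (dl j)) (E j)" for j
    unfolding E_def by (rule leading_component, rule wt_le) (auto simp: support_def)
  have rel: "delta j (R i) + R i * E j - E j * R i = R i * R j" for i j
    using leading_forms_relation[OF aut_relation R E] .
  \<comment> \<open>The case \<open>i = j\<close> of \<open>rel\<close> has the shape of a twisted
    square.\<close>
  have deg: "deg_le 1 (R i)" for i
    by (rule twisted_square_deg_le_1[OF L_no_zero_divisors rel])
  \<comment> \<open>Words of length at most 1 are settled by \<open>short_words\<close>; longer ones
    are excluded by \<open>deg\<close>.\<close>
  have R_eq: "R i = word_var i" for i
  proof (intro poly_mapping_eqI)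
    fix w a
    show "Poly_Mapping.lookup (Poly_Mapping.lookup (R i) w) a =
        Poly_Mapping.lookup (Poly_Mapping.lookup (word_var i) w) a"
    proof (cases "length (letters w) \<le> 1")
      case True
      then show ?thesis
        using lookup_word_var_wt[of i w a] by (auto simp: R_def lookup_component short_words when_def)
    next
      case False
      then have "Poly_Mapping.lookup (R i) w = 0"
        using deg by (auto simp: deg_le_def)
      moreover have "Poly_Mapping.lookup (word_var i) w = (0 :: ('n, 'k) L)"
        using False by (auto simp: lookup_word_var when_def)
      ultimately show ?thesis by simp
    qed
  qed
  \<comment> \<open>Once \<open>R i\<close> is r_i, the \<open>delta\<close> term in
    \<open>rel\<close> cancels r_i r_j, and what remains is that \<open>E j\<close> commutes with
    r_i.\<close>
  have E_0: "E j = 0" for j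
  proof (rule word_vars_centralizer[OF \<open>p0 \<noteq> p1\<close>])
    show "word_var p0 * E j = E j * word_var p0" "word_var p1 * E j = E j * word_var p1"
      using rel[of j p0] rel[of j p1] by (simp_all add: R_eq delta_word_var)
    show "Poly_Mapping.lookup (E j) 0 = 0"
      by (rule poly_mapping_eqI) (simp add: E_def lookup_component lookup_nf_aut_0)
  qed
  \<comment> \<open>As \<open>(w0, a0)\<close> has weight exactly \<open>1 - c\<close>, its
    coefficients survive in \<open>R i\<close> and \<open>E j\<close>, where they are now known to
    vanish.\<close>
  have "Poly_Mapping.lookup (Poly_Mapping.lookup (dr i) w0) a0 = 0" for i
  proof -
    have "Poly_Mapping.lookup (word_var i) w0 = (0 :: ('n, 'k) L)"
      using support_length[OF w0(1)] by (auto simp: lookup_word_var when_def)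
    then have "Poly_Mapping.lookup (Poly_Mapping.lookup (dr i) w0) a0 =
        Poly_Mapping.lookup (Poly_Mapping.lookup (R i) w0) a0"
      by (simp add: R_def lookup_component wt0 dr_def lookup_minus)
    also have "\<dots> = 0"
      using \<open>Poly_Mapping.lookup (word_var i) w0 = 0\<close> by (simp add: R_eq)
    finally show ?thesis .
  qed
  moreover have "Poly_Mapping.lookup (Poly_Mapping.lookup (nf (dl j)) w0) a0 = 0" for j
  proof -
    have "Poly_Mapping.lookup (Poly_Mapping.lookup (E j) w0) a0 = 0"
      by (simp add: E_0)
    then show ?thesis
      by (simp add: E_def lookup_component wt0)
  qed
  ultimately show False
    using w0(1) by (simp add: support_def)
qed

lemma aut_trivial_on_L_eq_id: "\<psi> = id"
proof
  have "dr i = 0" "nf (dl i) = 0" for i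
    using support_empty by (auto simp: support_def intro!: poly_mapping_eqI)
  then have "nf (\<psi> (U_r i)) = nf (U_r i)" "nf (dl i) = nf 0" for i
    by (simp_all add: dr_def nf_r)
  then have gens: "\<psi> (U_r i) = U_r i" "\<psi> (U_l i) = U_l i" for i
    by (simp_all only: nf_inject) (simp_all add: dl_def)
  have "alg_hom U_scale U_scale \<psi>"
    using aut by (simp add: mem_algebra_auts)
  from U_alg_hom_eqI[OF this alg_hom_id[OF vector_space_U_scale]] show "\<psi> u = id u" for u
    by (simp add: gens)
qed

end


theorem theorem3:
  assumes "CARD('n::finite) \<ge> 2"
  shows "Aut (U_scale :: 'k::field_char_0 \<Rightarrow> ('n, 'k) U \<Rightarrow> ('n, 'k) U)
       \<cong> Aut (pm_scale :: 'k \<Rightarrow> ('n, 'k) L \<Rightarrow> ('n, 'k) L)"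
proof -
  let ?U = "Aut (U_scale :: 'k \<Rightarrow> ('n, 'k) U \<Rightarrow> ('n, 'k) U)"
  let ?L = "Aut (pm_scale :: 'k \<Rightarrow> ('n, 'k) L \<Rightarrow> ('n, 'k) L)"
  let ?\<Theta> = "restrict_aut :: (('n, 'k) U \<Rightarrow> _) \<Rightarrow> _"
  obtain p0 p1 :: 'n where "p0 \<noteq> p1"
    using assms card_le_Suc0_iff_eq[of "UNIV :: 'n set"] by fastforce
  have "?\<Theta> \<in> hom ?U ?L"
    by (auto simp: hom_def Aut_def restrict_aut_in_auts
        restrict_aut_comp[OF conjunct2[OF iffD1[OF mem_algebra_auts]]])
  then interpret group_hom ?U ?L ?\<Theta>
    by (simp add: group_hom_def group_hom_axioms_def group_Aut vector_space_U_scale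
        vector_space_pm_scale)
  have "?\<Theta> \<in> iso ?U ?L"
    unfolding iso_iff
  proof (intro conjI subsetI ballI impI)
    \<comment> \<open>Surjectivity: the lift of \<open>\<phi>\<close> induces \<open>\<phi>\<close>,
      since \<open>U_to_L\<close> undoes \<open>L_to_U\<close>.\<close>
    fix \<phi> assume "\<phi> \<in> carrier ?L"
    then obtain \<psi> where \<psi>: "\<psi> \<in> algebra_auts U_scale" "\<And>f. \<psi> (L_to_U f) = L_to_U (\<phi> f)"
      by (auto simp: Aut_def elim: L_aut_lift)
    then have "?\<Theta> \<psi> = \<phi>"
      by (auto simp: restrict_aut_def)
    with \<psi>(1) show "\<phi> \<in> ?\<Theta> ` carrier ?U"
      by (auto simp: Aut_def)
  next
    \<comment> \<open>Injectivity, as triviality of the kernel.\<close>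
    fix \<psi> assume "\<psi> \<in> carrier ?U" "?\<Theta> \<psi> = \<one>\<^bsub>?L\<^esub>"
    then show "\<psi> = \<one>\<^bsub>?U\<^esub>"
      using aut_trivial_on_L_eq_id[OF _ _ \<open>p0 \<noteq> p1\<close>, of \<psi>] by (simp add: Aut_def)
  qed
  then show ?thesis
    by (auto simp: is_iso_def)
qed

end
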